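(* Fix $0<\alpha_0<\alpha_c=\frac{3\sqrt3}{2}$, and let $(\lambda_n)$ be a sequence of positive numbers such that $$0<\alpha_n:=\frac{\lambda_n}{n}\le\alpha_0,\qquad \Lambda_n:=(\lambda_n n^2)^{1/3}\longrightarrow\infty .$$ Set $\delta_n=\alpha_n^{1/3}$ and let $w_+=w_+(\delta_n)=u_n-iv_n$ be the right lower saddle for $\delta=\delta_n$. Then the Chebyshev coefficients $a_n(\lambda_n)$ of $F_{\lambda_n}$ satisfy $$a_n(\lambda_n)=(-1)^n\frac{4\delta_n}{\pi}\operatorname{Re}\left\{\frac{e^{\Lambda_n\Phi_{\delta_n}(w_+)}}{w_+^2+\delta_n^2}\sqrt{\frac{2\pi}{-\Lambda_n\Phi_{\delta_n}''(w_+)}}\right\}+O\!\left(\delta_n\Lambda_n^{-3/2}e^{\Lambda_n\operatorname{Re}\Phi_{\delta_n}(w_+)}\right),$$ where the square root is the branch continuous in $\delta$ that is positive at $\delta=0$, and the implied constant depends only on $\alpha_0$. Equivalently, the localized complex contribution $\mathcal C_n$ of the right saddle (before taking the real part) satisfies $$\mathcal C_n=\frac{e^{\Lambda_n\Phi_{\delta_n}(w_+)}}{w_+^2+\delta_n^2}\sqrt{\frac{2\pi}{-\Lambda_n\Phi_{\delta_n}''(w_+)}}\,\bigl(1+O(\Lambda_n^{-1})\bigr)$$ uniformly in the stated range of parameters.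
   Context: For $\lambda>0$, $F_\lambda(x)=\exp\!\left(-\lambda\frac{1-x}{1+x}\right)$ for $-1<x\le 1$ and $F_\lambda(-1)=0$. For $n\ge1$ its Chebyshev coefficient is $$a_n(\lambda)=\frac2\pi\int_{-1}^1\frac{F_\lambda(x)T_n(x)}{\sqrt{1-x^2}}\,dx ,$$ where $T_n$ is the Chebyshev polynomial of the first kind. Phase: for $\delta>0$, $\Phi_\delta(w)=-w^2+\frac1\delta\log\frac{w+i\delta}{w-i\delta}$, and $\Phi_0(w)=-w^2+\frac{2i}{w}$ for $w\ne0$; the branch of the logarithm is chosen locally. With $\delta=\delta_n$, $\Lambda=\Lambda_n$ one has $\Lambda_n/\delta_n=n$, so $e^{\Lambda_n\Phi_{\delta_n}(w)}=e^{-\Lambda_n w^2}\left(\frac{w+i\delta_n}{w-i\delta_n}\right)^n$ does not depend on the branch; $\operatorname{Re}\Phi_\delta$ and $\Phi_\delta''(w)=-2+\frac{4iw}{(w^2+\delta^2)^2}$ are also branch-independent. Saddles: let $\delta_c=\alpha_c^{1/3}$. For $0\le\delta<\delta_c$, the stationary-point equation $w(w^2+\delta^2)=-i$ has exactly two roots in the open lower half-plane, both simple, of the form $w_\pm(\delta)=\pm u(\delta)-iv(\delta)$ with $u(\delta),v(\delta)>0$; $w_+(\delta)$ is called the right lower saddle. At the saddle $\Phi_\delta''(w_+)=-6+4i\delta^2w_+$, so $-\Phi_0''(w_+(0))=6$ at $\delta=0$; the square root in the claim is continued in $\delta$ from its positive value there. Localized contribution: there is $\eta>0$, depending only on $\alpha_0$,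 such that the following definition is used. Fix an even cutoff $\chi\in C_c^\infty(\mathbb R)$ with $0\le\chi\le1$, $\chi(s)=1$ for $|s|\le\eta$, $\chi(s)=0$ for $|s|\ge2\eta$, and set $$\mathcal C_n=\int_{\mathbb R}\chi(x-u_n)\,\frac{e^{\Lambda_n\Phi_{\delta_n}(x-iv_n)}}{(x-iv_n)^2+\delta_n^2}\,dx .$$ *)

theory Defs
  imports "HOL-Analysis.Analysis"
begin

definition F :: "real \<Rightarrow> real \<Rightarrow> real" where
  "F lam x = (if x = -1 then 0 else exp (- lam * ((1 - x) / (1 + x))))"

fun chebyshev_T :: "nat \<Rightarrow> real \<Rightarrow> real" where
  "chebyshev_T 0 x = 1"
| "chebyshev_T (Suc 0) x = x"
| "chebyshev_T (Suc (Suc n)) x = 2 * x * chebyshev_T (Suc n) x - chebyshev_T n x"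

definition cheb_coeff :: "nat \<Rightarrow> real \<Rightarrow> real" where
  "cheb_coeff n lam =
     2 / pi * (LBINT x:{-1..1}. F lam x * chebyshev_T n x / sqrt (1 - x\<^sup>2))"

definition alpha_c :: real where
  "alpha_c = 3 * sqrt 3 / 2"

definition delta_c :: real where
  "delta_c = root 3 alpha_c"

(* For delta > 0 the principal logarithm gives a branch which is holomorphic off the
   segment from -i delta to i delta, hence near every point off the imaginary axis.
   Lemma exp_phase shows that this choice is immaterial for the exponential. *)
definition phase :: "real \<Rightarrow> complex \<Rightarrow> complex" where
  "phase \<delta> w =
     (if \<delta> = 0 then - w\<^sup>2 + 2 * \<i> / w
      else - w\<^sup>2 + Ln ((w + \<i> * of_real \<delta>) / (w - \<i> * of_real \<delta>)) / of_real \<delta>)"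

abbreviation phase'' :: "real \<Rightarrow> complex \<Rightarrow> complex" where
  "phase'' \<delta> w \<equiv> (deriv ^^ 2) (phase \<delta>) w"

lemma exp_phase:
  assumes "\<delta> > 0" "Lam / \<delta> = real n" "w \<noteq> \<i> * of_real \<delta>" "w \<noteq> - \<i> * of_real \<delta>"
  shows "exp (of_real Lam * phase \<delta> w) =
           exp (- of_real Lam * w\<^sup>2) * ((w + \<i> * of_real \<delta>) / (w - \<i> * of_real \<delta>)) ^ n"
proof -
  define q where "q = (w + \<i> * of_real \<delta>) / (w - \<i> * of_real \<delta>)"
  have q0: "q \<noteq> 0"
    using assms by (auto simp: q_def add_eq_0_iff2)
  have "Lam = real n * \<delta>"
    using assms by (simp add: field_simps)
  then have "of_real Lam * phase \<delta> w = - of_real Lam * w\<^sup>2 + of_nat n * Ln q"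
    using assms(1) by (simp add: phase_def q_def algebra_simps)
  then have "exp (of_real Lam * phase \<delta> w) = exp (- of_real Lam * w\<^sup>2) * exp (Ln q) ^ n"
    by (simp only: exp_add exp_of_nat_mult)
  then show ?thesis
    using q0 by (simp add: q_def)
qed

lemma phase''_eq:
  assumes "\<delta> \<ge> 0" "Re w \<noteq> 0"
  shows "phase'' \<delta> w = -2 + 4 * \<i> * w / (w\<^sup>2 + of_real (\<delta>\<^sup>2))\<^sup>2"
proof -
  let ?d = "complex_of_real \<delta>"
  let ?S = "{z. Re z \<noteq> 0}"
  have opn: "open ?S"
    by (intro open_Collect_neq continuous_intros)
  have nz: "z + \<i> * ?d \<noteq> 0" "z - \<i> * ?d \<noteq> 0" "z\<^sup>2 + ?d\<^sup>2 \<noteq> 0" if "Re z \<noteq> 0" for z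
  proof -
    show a: "z + \<i> * ?d \<noteq> 0" using that by (auto simp: complex_eq_iff)
    show b: "z - \<i> * ?d \<noteq> 0" using that by (auto simp: complex_eq_iff)
    have "z\<^sup>2 + ?d\<^sup>2 = (z + \<i> * ?d) * (z - \<i> * ?d)"
      by (simp add: algebra_simps power2_eq_square)
    then show "z\<^sup>2 + ?d\<^sup>2 \<noteq> 0" using a b by simp
  qed
  have d1: "(phase \<delta> has_field_derivative (- 2 * z - 2 * \<i> / (z\<^sup>2 + ?d\<^sup>2))) (at z)"
    if z: "Re z \<noteq> 0" for z
  proof (cases "\<delta> = 0")
    case True
    have "z \<noteq> 0" using z by auto
    then show ?thesis
      unfolding phase_def using True
      by (auto intro!: derivative_eq_intros simp: power2_eq_square)
  next
    case False
    have dpos: "\<delta> > 0" using False assms by simp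
    define q where "q = (z + \<i> * ?d) / (z - \<i> * ?d)"
    have cut: "q \<notin> \<real>\<^sub>\<le>\<^sub>0"
    proof
      assume "q \<in> \<real>\<^sub>\<le>\<^sub>0"
      then obtain t where t: "q = of_real t" "t \<le> 0"
        by (auto elim!: nonpos_Reals_cases)
      have "z + \<i> * ?d = of_real t * (z - \<i> * ?d)"
        using t(1) nz(2)[OF z] by (simp add: q_def field_simps)
      then have "Re z = t * Re z"
        by (auto simp: complex_eq_iff)
      then show False using z t(2) by simp
    qed
    have P: "phase \<delta> = (\<lambda>w. - w\<^sup>2 + Ln ((w + \<i> * ?d) / (w - \<i> * ?d)) / ?d)"
      using False by (auto simp: phase_def)
    have dq: "((\<lambda>w. (w + \<i> * ?d) / (w - \<i> * ?d)) has_field_derivative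
            (- 2 * \<i> * ?d / (z - \<i> * ?d)\<^sup>2)) (at z)"
      using nz(2)[OF z]
      by (auto intro!: derivative_eq_intros simp: field_simps power2_eq_square)
    have dLn: "((\<lambda>w. Ln ((w + \<i> * ?d) / (w - \<i> * ?d))) has_field_derivative
            (inverse q * (- 2 * \<i> * ?d / (z - \<i> * ?d)\<^sup>2))) (at z)"
      using DERIV_chain2[OF has_field_derivative_Ln[OF cut, unfolded q_def] dq]
      by (simp only: q_def)
    have dsq: "((\<lambda>w::complex. - w\<^sup>2) has_field_derivative - (2 * z)) (at z)"
      by (auto intro!: derivative_eq_intros)
    have "((\<lambda>w. - w\<^sup>2 + Ln ((w + \<i> * ?d) / (w - \<i> * ?d)) / ?d) has_field_derivative
            (- (2 * z) + (inverse q * (- 2 * \<i> * ?d / (z - \<i> * ?d)\<^sup>2)) / ?d)) (at z)"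
      by (rule DERIV_add[OF dsq DERIV_cdivide[OF dLn]])
    moreover have "(inverse q * (- 2 * \<i> * ?d / (z - \<i> * ?d)\<^sup>2)) / ?d = - 2 * \<i> / (z\<^sup>2 + ?d\<^sup>2)"
    proof -
      have f: "z\<^sup>2 + ?d\<^sup>2 = (z + \<i> * ?d) * (z - \<i> * ?d)"
        by (simp add: algebra_simps power2_eq_square)
      show ?thesis
        unfolding f q_def using nz[OF z] dpos by (simp add: power2_eq_square)
    qed
    ultimately show ?thesis unfolding P by simp
  qed
  have d2: "((\<lambda>z. - 2 * z - 2 * \<i> / (z\<^sup>2 + ?d\<^sup>2)) has_field_derivative
          (- 2 + 4 * \<i> * w / (w\<^sup>2 + ?d\<^sup>2)\<^sup>2)) (at w)"
    using nz(3)[OF assms(2)]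
    by (auto intro!: derivative_eq_intros simp: power2_eq_square)
  have ev: "eventually (\<lambda>z. deriv (phase \<delta>) z = - 2 * z - 2 * \<i> / (z\<^sup>2 + ?d\<^sup>2)) (nhds w)"
  proof -
    have "eventually (\<lambda>z. z \<in> ?S) (nhds w)"
      using eventually_nhds_in_open[OF opn] assms(2) by blast
    then show ?thesis
      by (rule eventually_mono) (blast intro: DERIV_imp_deriv d1)
  qed
  have "phase'' \<delta> w = deriv (deriv (phase \<delta>)) w"
    by (simp add: numeral_2_eq_2)
  also have "\<dots> = deriv (\<lambda>z. - 2 * z - 2 * \<i> / (z\<^sup>2 + ?d\<^sup>2)) w"
    by (rule deriv_cong_ev[OF ev refl])
  also have "\<dots> = - 2 + 4 * \<i> * w / (w\<^sup>2 + ?d\<^sup>2)\<^sup>2"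
    by (rule DERIV_imp_deriv[OF d2])
  finally show ?thesis by simp
qed

(* For 0 <= delta < delta_c the stationary-point equation has exactly two roots in the open
   lower half-plane, u - iv and -u - iv with u, v > 0; this is the one to the right. *)
definition saddle :: "real \<Rightarrow> complex" where
  "saddle \<delta> = (THE w. w * (w\<^sup>2 + of_real (\<delta>\<^sup>2)) = - \<i> \<and> Im w < 0 \<and> Re w > 0)"

definition is_sqrt_branch :: "real \<Rightarrow> (real \<Rightarrow> complex) \<Rightarrow> bool" where
  "is_sqrt_branch Lam r \<longleftrightarrow>
     continuous_on {0..<delta_c} r \<and>
     (\<forall>\<delta>\<in>{0..<delta_c}. (r \<delta>)\<^sup>2 = of_real (2 * pi) / (- of_real Lam * phase'' \<delta> (saddle \<delta>))) \<and>
     r 0 \<in> \<real> \<and> Re (r 0) > 0"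

(* The radicand does not vanish on [0, delta_c), so the values of a branch on this interval
   are unique and do not depend on the choice. *)
definition saddle_sqrt :: "real \<Rightarrow> real \<Rightarrow> complex" where
  "saddle_sqrt Lam = (SOME r. is_sqrt_branch Lam r)"

definition saddle_term :: "real \<Rightarrow> real \<Rightarrow> complex" where
  "saddle_term Lam \<delta> =
     exp (of_real Lam * phase \<delta> (saddle \<delta>)) / ((saddle \<delta>)\<^sup>2 + of_real (\<delta>\<^sup>2)) * saddle_sqrt Lam \<delta>"

definition cutoff :: "real \<Rightarrow> (real \<Rightarrow> real) \<Rightarrow> bool" where
  "cutoff \<eta> chi \<longleftrightarrow>
     (\<forall>k x. (deriv ^^ k) chi field_differentiable (at x)) \<and>
     compact (closure {s. chi s \<noteq> 0}) \<and>
     (\<forall>s. chi (- s) = chi s) \<and>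
     (\<forall>s. 0 \<le> chi s \<and> chi s \<le> 1) \<and>
     (\<forall>s. \<bar>s\<bar> \<le> \<eta> \<longrightarrow> chi s = 1) \<and>
     (\<forall>s. \<bar>s\<bar> \<ge> 2 * \<eta> \<longrightarrow> chi s = 0)"

definition local_contrib :: "(real \<Rightarrow> real) \<Rightarrow> real \<Rightarrow> real \<Rightarrow> complex" where
  "local_contrib chi Lam \<delta> =
     (let u = Re (saddle \<delta>); v = - Im (saddle \<delta>) in
      LBINT x. of_real (chi (x - u)) *
        (exp (of_real Lam * phase \<delta> (Complex x (- v))) / ((Complex x (- v))\<^sup>2 + of_real (\<delta>\<^sup>2))))"

end

theory Submission
  imports Defs "HOL-Probability.Distributions" "HOL-Complex_Analysis.Cauchy_Integral_Theorem"
begin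

text \<open>
  The substitution \<open>x = (\<delta>\<^sup>2 - w\<^sup>2) / (\<delta>\<^sup>2 + w\<^sup>2)\<close> turns the Chebyshev coefficient into the integral of
  \<open>exp (\<Lambda> \<Phi>) / (w\<^sup>2 + \<delta>\<^sup>2)\<close> over the positive real axis (\<open>cheb_coeff_eq_half_line_integral\<close>). The integrand is
  holomorphic below the real axis, so the contour can be moved down to the horizontal line through the
  two lower saddles \<open>\<plusminus>u - \<i> v\<close>. By symmetry the two halves of this line
  contribute the same real part, and the right half suffices (\<open>cheb_coeff_eq_shifted_integral\<close>).

  On this line \<open>Re \<Phi>\<close> is a concave function of \<open>x\<^sup>2\<close> with maximum at \<open>u\<^sup>2\<close>; a direct estimate with
  \<open>ln z \<le> z - 1\<close> yields Gaussian decay about the saddle on the whole half line, with constants depending only on a lower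
  bound for \<open>u\<close> (\<open>kernel_bound\<close>). Such a bound is uniform for \<open>\<alpha> \<le> \<alpha>0 < alpha_c\<close>, as the saddle depends
  continuously on \<open>\<delta>\<close> and reaches the imaginary axis only at \<open>delta_c\<close>
  (\<open>saddle_Re_lower_bound\<close>).

  Near the saddle, the phase and the amplitude are expanded to third and first order with
  explicit remainders (\<open>phase_expansion\<close>, \<open>amplitude_expansion\<close>). Laplace's method for an even cutoff
  (\<open>laplace_even_cutoff\<close>) then gives the local contribution with relative error \<open>O(1 / \<Lambda>)\<close>, as all terms of
  relative order \<open>\<Lambda> powr (- 1 / 2)\<close> are odd about the saddle. Its leading term is a complex Gaussian
  integral, and contains the principal square root. This is the continuous branch that is positive at \<open>\<delta> = 0\<close>, because
  \<open>- \<Phi>''\<close> has positive real part at all saddles (\<open>saddle_sqrt_eq_csqrt\<close>).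

  The smooth cutoff gives the statement on the localized contribution. The sharp one, together with
  the decay away from the saddle (\<open>kernel_tail_bound\<close>), gives the one on the coefficient.
\<close>

section \<open>Gaussian integrals and Laplace's method\<close>

lemma has_bochner_integral_gaussian:
  fixes c :: real
  assumes "c > 0"
  shows "has_bochner_integral lborel (\<lambda>x. exp (- c * x\<^sup>2)) (sqrt (pi / c))"
proof -
  define s where "s = 1 / sqrt (2 * c)"
  have s: "s > 0" and s2: "s\<^sup>2 = 1 / (2 * c)"
    using assms by (auto simp: s_def power_divide)
  have "has_bochner_integral lborel (normal_density 0 s) 1"
    using s by (simp add: has_bochner_integral_iff)
  then have "has_bochner_integral lborel (\<lambda>x. normal_density 0 s x * sqrt (pi / c)) (1 * sqrt (pi / c))"
    by (rule has_bochner_integral_mult_left)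
  moreover have "normal_density 0 s x * sqrt (pi / c) = exp (- c * x\<^sup>2)" for x
  proof -
    have "normal_density 0 s x = 1 / sqrt (pi / c) * exp (- c * x\<^sup>2)"
      using assms by (simp add: normal_density_def s2 field_simps)
    then show ?thesis using assms by simp
  qed
  ultimately show ?thesis by simp
qed

text \<open>
  Every error term below is controlled pointwise by a real Gaussian; this turns such a bound into
  integrability and into a bound of the integral, with the factor \<open>1 / sqrt c\<close> that supplies
  a power of the large parameter.
\<close>

lemma integral_dominated_by_gaussian:
  fixes f :: "real \<Rightarrow> complex"
  assumes "c > 0" and f: "f \<in> borel_measurable borel"
    and le: "\<And>x. norm (f x) \<le> B * exp (- c * (x - u)\<^sup>2)"
  shows "integrable lborel f" and "norm (LBINT x. f x) \<le> B * sqrt (pi / c)"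
proof -
  have "has_bochner_integral lborel (\<lambda>x. exp (- c * (x - u)\<^sup>2)) (sqrt (pi / c))"
    using lborel_has_bochner_integral_real_affine_iff
        [of 1 "\<lambda>x. exp (- c * x\<^sup>2)" "sqrt (pi / c)" "- u"] has_bochner_integral_gaussian[OF assms(1)]
    by simp
  then have g: "has_bochner_integral lborel (\<lambda>x. B * exp (- c * (x - u)\<^sup>2)) (B * sqrt (pi / c))"
    by (rule has_bochner_integral_mult_right)
  show i: "integrable lborel f"
  proof (rule Bochner_Integration.integrable_bound)
    show "integrable lborel (\<lambda>x. B * exp (- c * (x - u)\<^sup>2))"
      using g by (simp add: has_bochner_integral_iff)
    show "AE x in lborel. norm (f x) \<le> norm (B * exp (- c * (x - u)\<^sup>2))"
      using le by (intro AE_I2) (metis abs_ge_self order_trans real_norm_def)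
  qed (use f in simp)
  have "norm (LBINT x. f x) \<le> (LBINT x. B * exp (- c * (x - u)\<^sup>2))"
    using g i le by (intro Bochner_Integration.integral_norm_bound_integral) (auto simp: has_bochner_integral_iff)
  then show "norm (LBINT x. f x) \<le> B * sqrt (pi / c)"
    by (simp only: has_bochner_integral_integral_eq[OF g])
qed

text \<open>
  Polynomial factors are traded for a small part of the Gaussian exponent.
\<close>

lemma le_exp_over: "t \<le> exp (a * t) / a" if "a > 0" for a t :: real
  using exp_ge_add_one_self[of "a * t"] that by (simp add: field_simps, linarith)

lemma abs_times_gaussian_tendsto_0:
  fixes c :: real
  assumes "c > 0"
  shows "((\<lambda>x. \<bar>x\<bar> * exp (- c * x\<^sup>2)) \<longlongrightarrow> 0) at_infinity"
proof (rule Lim_null_comparison)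
  show "\<forall>\<^sub>F x in at_infinity. norm (\<bar>x\<bar> * exp (- c * x\<^sup>2)) \<le> \<bar>inverse x\<bar> / c"
  proof (rule always_eventually, rule allI)
    fix x :: real
    have "x\<^sup>2 * exp (- c * x\<^sup>2) \<le> 1 / c"
      using le_exp_over[OF assms, of "x\<^sup>2"] by (simp add: exp_minus field_simps)
    then have *: "\<bar>x\<bar> * (\<bar>x\<bar> * exp (- c * x\<^sup>2)) \<le> 1 / c"
      by (simp add: power2_eq_square flip: mult.assoc)
    show "norm (\<bar>x\<bar> * exp (- c * x\<^sup>2)) \<le> \<bar>inverse x\<bar> / c"
    proof (cases "x = 0")
      case False
      then have "norm (\<bar>x\<bar> * exp (- c * x\<^sup>2)) = \<bar>x\<bar> * (\<bar>x\<bar> * exp (- c * x\<^sup>2)) * \<bar>inverse x\<bar>"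
        by (simp add: abs_mult)
      also have "\<dots> \<le> 1 / c * \<bar>inverse x\<bar>" using * by (rule mult_right_mono) simp
      finally show ?thesis by simp
    qed simp
  qed
  have "((\<lambda>x::real. \<bar>inverse x\<bar> / c) \<longlongrightarrow> \<bar>0\<bar> / c) at_infinity"
    using assms by (intro tendsto_intros tendsto_inverse_0) auto
  then show "((\<lambda>x::real. \<bar>inverse x\<bar> / c) \<longlongrightarrow> 0) at_infinity" by simp
qed

text \<open>
  Both contour deformations of the proof take this form: \<open>h\<close> is the difference of the integrands
  along two lines, and \<open>G\<close> the difference of one holomorphic primitive along these lines. It tends to \<open>0\<close>
  because far out the integrand is small on the segments that join the two lines.
\<close>

lemma integral_vanishes_if_primitive_vanishes:
  fixes G h :: "real \<Rightarrow> complex"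
  assumes der: "\<And>x. (G has_vector_derivative h x) (at x)"
    and cont: "\<And>x. isCont h x" and int: "integrable lborel h"
    and lim: "(G \<longlongrightarrow> 0) at_infinity"
  shows "(LBINT x. h x) = 0"
proof -
  have "(G \<longlongrightarrow> 0) at_top" "(G \<longlongrightarrow> 0) at_bot"
    using lim at_top_le_at_infinity at_bot_le_at_infinity by (auto intro: tendsto_mono)
  then have "(LBINT x=-\<infinity>..\<infinity>. h x) = 0 - 0"
    using der cont int
    by (intro interval_integral_FTC_integrable[where F = G])
       (auto simp: ereal_tendsto_simps set_integrable_def)
  then show ?thesis
    by (simp add: interval_lebesgue_integral_def set_lebesgue_integral_def)
qed

text \<open>
  With \<open>q = csqrt z\<close> the integrand is \<open>exp (- (q x)\<^sup>2 / 2)\<close>, that is, \<open>exp (- w\<^sup>2 / 2)\<close> along the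
  line through \<open>0\<close> and \<open>q\<close>. Turning this line into the real axis does not change the integral of
  \<open>exp (- w\<^sup>2 / 2) dw\<close>: since \<open>Re (q\<^sup>2) > 0\<close>, the integrand decays in the whole sector between the
  lines. What remains is the real Gaussian.
\<close>

lemma has_bochner_integral_complex_gaussian:
  fixes z :: complex
  assumes "Re z > 0"
  shows "has_bochner_integral lborel (\<lambda>x. exp (- z * of_real (x\<^sup>2) / 2)) (csqrt (2 * pi / z))"
proof -
  define q where "q = csqrt z"
  define a where "a = Re q"
  define b where "b = Im q"
  have q2: "q\<^sup>2 = z" by (simp add: q_def)
  have q: "q = Complex a b" by (simp add: a_def b_def)
  have Rez: "Re z = a\<^sup>2 - b\<^sup>2" by (simp flip: q2 add: a_def b_def power2_eq_square)
  have "a \<ge> 0" unfolding a_def q_def using csqrt_principal[of z] by linarith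
  have "a \<noteq> 0" using assms Rez by (auto simp: not_less)
  with \<open>a \<ge> 0\<close> have a: "a > 0" by simp
  define c where "c = (a\<^sup>2 - b\<^sup>2) / 2"
  have c: "c > 0" using assms Rez by (simp add: c_def)
  define f where "f = (\<lambda>w::complex. exp (- w\<^sup>2 / 2))"
  have fq: "f (q * of_real x) = exp (- z * of_real (x\<^sup>2) / 2)" for x
    by (simp add: f_def power_mult_distrib q2)
  have fa: "f (of_real a * of_real x) = of_real (exp (- (a\<^sup>2 / 2) * x\<^sup>2))" for x
    by (simp add: f_def power_mult_distrib exp_of_real[symmetric])
  have "f holomorphic_on UNIV"
    unfolding f_def by (intro holomorphic_intros) auto
  then obtain G where G: "\<And>w. (G has_field_derivative f w) (at w)"
    using holomorphic_convex_primitive'[of UNIV f] by auto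
  have iq: "integrable lborel (\<lambda>x. exp (- z * of_real (x\<^sup>2) / 2))"
    using c by (intro integral_dominated_by_gaussian[where c = c and B = 1 and u = 0])
       (auto simp: Rez c_def)
  have ia: "has_bochner_integral lborel (\<lambda>x. f (of_real a * of_real x)) (of_real (sqrt (pi / (a\<^sup>2 / 2))))"
    unfolding fa using a by (intro has_bochner_integral_of_real has_bochner_integral_gaussian) auto
  define h where "h = (\<lambda>x. q * f (q * of_real x) - of_real a * f (of_real a * of_real x))"
  have "(LBINT x. h x) = 0"
  proof (rule integral_vanishes_if_primitive_vanishes)
    have d: "((\<lambda>x. G (p * of_real x)) has_vector_derivative p * f (p * of_real x)) (at x)" for p x
    proof -
      have "((\<lambda>x. p * of_real x) has_vector_derivative p) (at x)"
        by (auto intro!: derivative_eq_intros)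
      from field_vector_diff_chain_at[OF this G] show ?thesis
        by (simp add: o_def)
    qed
    show "((\<lambda>x. G (q * of_real x) - G (of_real a * of_real x)) has_vector_derivative h x) (at x)" for x
      unfolding h_def by (intro has_vector_derivative_diff d)
    show "isCont h x" for x
      unfolding h_def f_def by (intro continuous_intros) auto
    show "integrable lborel h"
      unfolding h_def using iq ia by (auto simp: fq has_bochner_integral_iff)
    show "((\<lambda>x. G (q * of_real x) - G (of_real a * of_real x)) \<longlongrightarrow> 0) at_infinity"
    proof (rule Lim_null_comparison)
      show "\<forall>\<^sub>F x in at_infinity. norm (G (q * of_real x) - G (of_real a * of_real x))
              \<le> \<bar>b\<bar> * (\<bar>x\<bar> * exp (- c * x\<^sup>2))"
      proof (rule always_eventually, rule allI)
        fix x :: real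
        \<comment> \<open>The vertical segment between the two lines: \<open>Re (w\<^sup>2)\<close> is smallest at its end \<open>q x\<close>.\<close>
        let ?S = "closed_segment (of_real a * of_real x) (q * of_real x)"
        have "norm (G (q * of_real x) - G (of_real a * of_real x))
                \<le> exp (- c * x\<^sup>2) * norm (q * of_real x - of_real a * of_real x)"
        proof (rule field_differentiable_bound[where S = ?S])
          fix w assume "w \<in> ?S"
          then obtain t where t: "0 \<le> t" "t \<le> 1"
            and w: "w = (1 - t) *\<^sub>R (of_real a * of_real x) + t *\<^sub>R (q * of_real x)"
            by (auto simp: closed_segment_def)
          have "Re w = a * x" "Im w = t * (b * x)"
            by (auto simp: w q algebra_simps)
          then have "Re (w\<^sup>2) = (a * x)\<^sup>2 - t\<^sup>2 * (b * x)\<^sup>2"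
            by (simp add: power2_eq_square algebra_simps)
          moreover have "t\<^sup>2 * (b * x)\<^sup>2 \<le> (b * x)\<^sup>2"
            using t by (intro mult_left_le_one_le) (auto simp: power_le_one)
          ultimately show "norm (f w) \<le> exp (- c * x\<^sup>2)"
            by (simp add: f_def c_def field_simps)
        qed (use G in \<open>auto intro: has_field_derivative_at_within\<close>)
        also have "q * of_real x - of_real a * of_real x = \<i> * of_real (b * x)"
          by (simp add: q complex_eq_iff)
        finally show "norm (G (q * of_real x) - G (of_real a * of_real x))
              \<le> \<bar>b\<bar> * (\<bar>x\<bar> * exp (- c * x\<^sup>2))"
          by (simp add: norm_mult abs_mult mult_ac)
      qed
      show "((\<lambda>x. \<bar>b\<bar> * (\<bar>x\<bar> * exp (- c * x\<^sup>2))) \<longlongrightarrow> 0) at_infinity"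
        by (intro tendsto_mult_right_zero abs_times_gaussian_tendsto_0 c)
    qed
  qed
  also have "(LBINT x. h x) = q * (LBINT x. f (q * of_real x)) - of_real a * of_real (sqrt (pi / (a\<^sup>2 / 2)))"
    unfolding h_def using iq ia by (simp add: fq has_bochner_integral_iff)
  also have "of_real a * of_real (sqrt (pi / (a\<^sup>2 / 2))) = (of_real (sqrt (2 * pi)) :: complex)"
  proof -
    have "a * sqrt (pi / (a\<^sup>2 / 2)) = sqrt (2 * pi)"
      using a by (simp add: real_sqrt_divide real_sqrt_mult)
    then show ?thesis by (simp flip: of_real_mult)
  qed
  finally have val: "q * (LBINT x. f (q * of_real x)) = of_real (sqrt (2 * pi))" by simp
  have "q \<noteq> 0" using a by (auto simp: a_def)
  with val have "(LBINT x. f (q * of_real x)) = of_real (sqrt (2 * pi)) / q"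
    by (simp add: field_simps)
  also have "\<dots> = csqrt (2 * pi / z)"
  proof (rule csqrt_unique[symmetric])
    show "(of_real (sqrt (2 * pi)) / q)\<^sup>2 = 2 * pi / z"
      by (simp add: power_divide q2 flip: of_real_power)
    have "Re (of_real (sqrt (2 * pi)) / q) > 0"
      using a \<open>q \<noteq> 0\<close> by (simp add: Re_divide q sum_power2_gt_zero_iff)
    then show "0 < Re (of_real (sqrt (2 * pi)) / q) \<or>
        Re (of_real (sqrt (2 * pi)) / q) = 0 \<and> 0 \<le> Im (of_real (sqrt (2 * pi)) / q)" by simp
  qed
  finally show ?thesis
    using iq by (simp add: fq has_bochner_integral_iff)
qed

lemma integral_odd_eq_0:
  fixes f :: "real \<Rightarrow> complex"
  assumes "\<And>x. f (- x) = - f x"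
  shows "(LBINT x. f x) = 0"
proof -
  have "(LBINT x. f x) = - (LBINT x. f x)"
    using lborel_integral_real_affine[of "-1" f 0] by (simp add: assms)
  then show ?thesis by (simp add: eq_neg_iff_add_eq_0 flip: mult_2)
qed

text \<open>
  Expand the integrand of Laplace's method about a critical point, with
  \<open>\<psi> = - \<kappa>/2 y\<^sup>2 + p y\<^sup>3 + O(y\<^sup>4)\<close> and amplitude \<open>g = g0 + g1 y + O(y\<^sup>2)\<close>. All terms kept besides \<open>g0\<close>
  are odd in \<open>y\<close> and disappear on integration against an even weight; the terms dropped are of the types
  \<open>y\<^sup>2\<close>, \<open>L y\<^sup>4\<close> and \<open>L\<^sup>2 y\<^sup>6\<close>, each of which gains a factor \<open>1 / L\<close> under the Gaussian.
  Half of the Gaussian decay pays for \<open>exp Z\<close>, where \<open>Z\<close> collects the terms of the exponent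
  beyond the quadratic one: this is why \<open>y\<close> has to be small compared to \<open>c / M\<close>.
\<close>

lemma laplace_integrand_expansion:
  fixes \<psi> g \<kappa> p g0 g1 :: complex and y L c M :: real
  assumes L: "L > 0" and y: "\<bar>y\<bar> \<le> 1" "2 * M * \<bar>y\<bar> \<le> c" and \<kappa>: "Re \<kappa> \<ge> 4 * c"
    and \<psi>: "norm (\<psi> + \<kappa> / 2 * of_real y ^ 2 - p * of_real y ^ 3) \<le> M * y ^ 4"
    and g: "norm (g - g0 - g1 * of_real y) \<le> M * y\<^sup>2"
    and M: "norm p \<le> M" "norm g0 \<le> M" "norm g1 \<le> M"
  shows "norm (exp (of_real L * \<psi>) * g
            - exp (- (of_real L * \<kappa>) * of_real (y\<^sup>2) / 2) *
              (g0 + (g1 * of_real y + of_real L * g0 * p * of_real y ^ 3)))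
          \<le> exp (- c * (L * y\<^sup>2)) * (M * y\<^sup>2 + 5 * M\<^sup>2 * L * y ^ 4 + 12 * M ^ 3 * L\<^sup>2 * y ^ 6)"
proof -
  have M0: "M \<ge> 0" using M(1) norm_ge_zero[of p] by linarith
  define E where "E = exp (- (of_real L * \<kappa>) * of_real (y\<^sup>2) / 2)"
  define Z where "Z = of_real L * (\<psi> + \<kappa> / 2 * of_real y ^ 2)"
  have EZ: "exp (of_real L * \<psi>) = E * exp Z"
    unfolding E_def Z_def exp_add[symmetric] by (rule arg_cong[of _ _ exp]) (simp add: algebra_simps)
  have y4: "y ^ 4 \<le> \<bar>y\<bar> ^ 3"
    using power_decreasing[of 3 4 "\<bar>y\<bar>"] y by simp
  have y1: "y\<^sup>2 \<le> 1" using y(1) by (simp add: abs_square_le_1)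
  have Zp: "norm (Z - of_real L * p * of_real y ^ 3) \<le> L * (M * y ^ 4)"
  proof -
    have "Z - of_real L * p * of_real y ^ 3 = of_real L * (\<psi> + \<kappa> / 2 * of_real y ^ 2 - p * of_real y ^ 3)"
      by (simp add: Z_def algebra_simps)
    then show ?thesis using \<psi> L by (simp add: norm_mult)
  qed
  have Zle: "norm Z \<le> 2 * M * L * \<bar>y\<bar> ^ 3"
  proof -
    have "norm Z \<le> norm (of_real L * p * of_real y ^ 3) + L * (M * y ^ 4)"
      using norm_triangle_sub[of Z "of_real L * p * of_real y ^ 3"] Zp by linarith
    also have "norm (of_real L * p * of_real y ^ 3) \<le> L * M * \<bar>y\<bar> ^ 3"
      using L M M0 by (auto simp: norm_mult norm_power intro!: mult_mono)
    also have "L * (M * y ^ 4) \<le> L * (M * \<bar>y\<bar> ^ 3)"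
      using L M0 y4 by (intro mult_left_mono) auto
    finally show ?thesis by (simp add: mult_ac)
  qed
  have Zc: "norm Z \<le> c * (L * y\<^sup>2)"
  proof -
    have "2 * M * L * \<bar>y\<bar> ^ 3 = (2 * M * \<bar>y\<bar>) * (L * \<bar>y\<bar>\<^sup>2)"
      by (simp only: power3_eq_cube power2_eq_square mult_ac)
    also have "\<dots> = (2 * M * \<bar>y\<bar>) * (L * y\<^sup>2)" by simp
    also have "\<dots> \<le> c * (L * y\<^sup>2)" using y L by (intro mult_right_mono) auto
    finally show ?thesis using Zle by linarith
  qed
  have Z2: "(norm Z)\<^sup>2 \<le> 4 * M\<^sup>2 * L\<^sup>2 * y ^ 6"
  proof -
    have "(norm Z)\<^sup>2 \<le> (2 * M * L * \<bar>y\<bar> ^ 3)\<^sup>2" using Zle by (intro power_mono) auto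
    also have "\<dots> = 4 * M\<^sup>2 * L\<^sup>2 * \<bar>y\<bar> ^ 6" by (simp only: power_mult_distrib power_mult[symmetric]) simp
    also have "\<bar>y\<bar> ^ 6 = y ^ 6" by simp
    finally show ?thesis .
  qed
  have gle: "norm g \<le> 3 * M"
  proof -
    have "norm g \<le> norm (g - g0 - g1 * of_real y) + (norm g0 + norm (g1 * of_real y))"
      using norm_triangle_ineq[of "g - g0 - g1 * of_real y" "g0 + g1 * of_real y"]
        norm_triangle_ineq[of g0 "g1 * of_real y"] by simp
    also have "norm (g - g0 - g1 * of_real y) \<le> M" using g y1 M0 mult_left_mono[of "y\<^sup>2" 1 M] by auto
    also have "norm (g1 * of_real y) \<le> M * 1" using M y unfolding norm_mult norm_of_real
      by (intro mult_mono) (use M0 in auto)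

    finally show ?thesis using M by linarith
  qed
  have gle2: "norm (g - g0) \<le> 2 * M * \<bar>y\<bar>"
  proof -
    have "norm (g - g0) \<le> norm (g - g0 - g1 * of_real y) + norm (g1 * of_real y)"
      using norm_triangle_sub[of "g - g0" "g1 * of_real y"] by simp
    also have "norm (g1 * of_real y) \<le> M * \<bar>y\<bar>" using M by (auto simp: norm_mult intro!: mult_right_mono)
    also have "norm (g - g0 - g1 * of_real y) \<le> M * \<bar>y\<bar>"
    proof -
      have "y\<^sup>2 \<le> \<bar>y\<bar>" using power_decreasing[of 1 2 "\<bar>y\<bar>"] y by simp
      then show ?thesis using g M0 mult_left_mono[of "y\<^sup>2" "\<bar>y\<bar>" M] by linarith
    qed
    finally show ?thesis by linarith
  qed
  define T where "T = c * (L * y\<^sup>2)"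
  have T0: "T \<ge> 0" using Zc norm_ge_zero[of Z] unfolding T_def by linarith
  have E1: "norm E \<le> exp (- T) * exp (- T)"
  proof -
    have "4 * c * (L * y\<^sup>2) \<le> Re \<kappa> * (L * y\<^sup>2)" using \<kappa> L by (intro mult_right_mono) auto
    then show ?thesis by (simp add: E_def T_def field_simps flip: exp_add)
  qed
  have e1: "exp (- T) \<le> 1" using T0 by simp
  have R: "norm (exp Z - 1 - Z) \<le> exp T * (4 * M\<^sup>2 * L\<^sup>2 * y ^ 6)"
  proof -
    have "norm (exp Z - (1 + Z)) \<le> exp \<bar>Re Z\<bar> * (norm Z)\<^sup>2"
      using Taylor_exp[of Z 1] by (simp add: power2_eq_square)
    also have "\<dots> \<le> exp T * (4 * M\<^sup>2 * L\<^sup>2 * y ^ 6)"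
      using Z2 Zc abs_Re_le_cmod[of Z] by (intro mult_mono) (auto simp: T_def)
    finally show ?thesis by (simp add: diff_diff_eq)
  qed
  define S where "S = M * y\<^sup>2 + 5 * M\<^sup>2 * L * y ^ 4"
  have S0: "S \<ge> 0" unfolding S_def using M0 L by (auto intro!: add_nonneg_nonneg mult_nonneg_nonneg)
  have mid: "norm ((g - g0 - g1 * of_real y) + Z * (g - g0) + g0 * (Z - of_real L * p * of_real y ^ 3)) \<le> S"
  proof -
    have "norm (Z * (g - g0)) \<le> (2 * M * L * \<bar>y\<bar> ^ 3) * (2 * M * \<bar>y\<bar>)"
      unfolding norm_mult using Zle gle2 M0 L by (intro mult_mono) auto
    also have "\<dots> = 4 * M\<^sup>2 * L * \<bar>y\<bar> ^ 4"
      by (simp add: power2_eq_square power4_eq_xxxx power3_eq_cube)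
    also have "\<bar>y\<bar> ^ 4 = y ^ 4" by simp
    finally have 1: "norm (Z * (g - g0)) \<le> 4 * M\<^sup>2 * L * y ^ 4" .
    have "norm (g0 * (Z - of_real L * p * of_real y ^ 3)) \<le> M * (L * (M * y ^ 4))"
      unfolding norm_mult using Zp M M0 by (intro mult_mono) auto
    then have 2: "norm (g0 * (Z - of_real L * p * of_real y ^ 3)) \<le> M\<^sup>2 * L * y ^ 4"
      by (simp add: power2_eq_square mult_ac)
    show ?thesis unfolding S_def
      using norm_triangle_ineq[of "(g - g0 - g1 * of_real y) + Z * (g - g0)" "g0 * (Z - of_real L * p * of_real y ^ 3)"]
        norm_triangle_ineq[of "g - g0 - g1 * of_real y" "Z * (g - g0)"] 1 2 g by linarith
  qed
  have "exp (of_real L * \<psi>) * g - E * (g0 + (g1 * of_real y + of_real L * g0 * p * of_real y ^ 3))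
      = E * ((exp Z - 1 - Z) * g
          + ((g - g0 - g1 * of_real y) + Z * (g - g0) + g0 * (Z - of_real L * p * of_real y ^ 3)))"
    unfolding EZ by (simp add: algebra_simps)
  then have "norm (exp (of_real L * \<psi>) * g - E * (g0 + (g1 * of_real y + of_real L * g0 * p * of_real y ^ 3)))
      \<le> norm E * (norm (exp Z - 1 - Z) * norm g + S)"
    using mid by (auto simp: norm_mult intro!: mult_left_mono intro: order_trans[OF norm_triangle_ineq])
  also have "\<dots> \<le> (exp (- T) * exp (- T)) * ((exp T * (4 * M\<^sup>2 * L\<^sup>2 * y ^ 6)) * (3 * M) + S)"
    using E1 R gle S0 M0 by (intro mult_mono add_mono order_refl) (auto intro!: add_nonneg_nonneg)
  also have "\<dots> = exp (- T) * (12 * M ^ 3 * L\<^sup>2 * y ^ 6 + exp (- T) * S)"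
    by (simp add: algebra_simps power3_eq_cube power2_eq_square exp_minus)
  also have "\<dots> \<le> exp (- T) * (12 * M ^ 3 * L\<^sup>2 * y ^ 6 + 1 * S)"
    using e1 S0 by (intro mult_left_mono add_left_mono mult_right_mono) auto
  finally show ?thesis by (simp add: E_def T_def S_def algebra_simps)
qed


text \<open>
  With \<open>t = L y\<^sup>2\<close> each power of \<open>t\<close> is bounded by the same power of \<open>exp (c/6 t) / (c/6)\<close>. As at most three factors occur, this
  uses up at most half of the decay \<open>exp (- c t)\<close>.
\<close>

lemma laplace_error_term_bound:
  fixes M c L :: real
  assumes "c > 0" "M \<ge> 0" "L > 0"
  shows "exp (- c * (L * y\<^sup>2)) * (M * y\<^sup>2 + 5 * M\<^sup>2 * L * y ^ 4 + 12 * M ^ 3 * L\<^sup>2 * y ^ 6)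
          \<le> (M / (c / 6) + 5 * M\<^sup>2 / (c / 6)\<^sup>2 + 12 * M ^ 3 / (c / 6) ^ 3) / L * exp (- (c / 2 * L) * y\<^sup>2)"
proof -
  define a where "a = c / 6"
  define t where "t = L * y\<^sup>2"
  have a: "a > 0" and t: "t \<ge> 0" using assms by (auto simp: a_def t_def)
  define X where "X = exp (a * t)"
  have X1: "X \<ge> 1" using a t by (simp add: X_def)
  have t1: "t \<le> X / a" using le_exp_over[OF a, of t] by (simp add: X_def)
  have t2: "t\<^sup>2 \<le> (X / a)\<^sup>2" "t ^ 3 \<le> (X / a) ^ 3" using t1 t by (auto intro: power_mono)
  have X2: "X \<le> X ^ 3" "X\<^sup>2 \<le> X ^ 3"
    using power_increasing[of 1 3 X] power_increasing[of 2 3 X] X1 by auto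
  have "L * (M * y\<^sup>2 + 5 * M\<^sup>2 * L * y ^ 4 + 12 * M ^ 3 * L\<^sup>2 * y ^ 6) = M * t + 5 * M\<^sup>2 * t\<^sup>2 + 12 * M ^ 3 * t ^ 3"
    by (simp add: t_def eval_nat_numeral algebra_simps)
  also have "\<dots> \<le> M * (X / a) + 5 * M\<^sup>2 * (X / a)\<^sup>2 + 12 * M ^ 3 * (X / a) ^ 3"
    using t1 t2 assms by (intro add_mono mult_left_mono) auto
  also have "\<dots> = M / a * X + 5 * M\<^sup>2 / a\<^sup>2 * X\<^sup>2 + 12 * M ^ 3 / a ^ 3 * X ^ 3"
    by (simp add: power_divide)
  also have "\<dots> \<le> M / a * X ^ 3 + 5 * M\<^sup>2 / a\<^sup>2 * X ^ 3 + 12 * M ^ 3 / a ^ 3 * X ^ 3"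
    using X2 assms a by (intro add_mono mult_left_mono) auto
  also have "\<dots> = (M / a + 5 * M\<^sup>2 / a\<^sup>2 + 12 * M ^ 3 / a ^ 3) * X ^ 3"
    by (simp add: algebra_simps)
  finally have "M * y\<^sup>2 + 5 * M\<^sup>2 * L * y ^ 4 + 12 * M ^ 3 * L\<^sup>2 * y ^ 6
      \<le> (M / a + 5 * M\<^sup>2 / a\<^sup>2 + 12 * M ^ 3 / a ^ 3) * X ^ 3 / L"
    using assms by (simp add: field_simps)
  then have "exp (- c * (L * y\<^sup>2)) * (M * y\<^sup>2 + 5 * M\<^sup>2 * L * y ^ 4 + 12 * M ^ 3 * L\<^sup>2 * y ^ 6)
      \<le> exp (- c * (L * y\<^sup>2)) * ((M / a + 5 * M\<^sup>2 / a\<^sup>2 + 12 * M ^ 3 / a ^ 3) * X ^ 3 / L)"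
    by (intro mult_left_mono) auto
  also have "\<dots> = (M / a + 5 * M\<^sup>2 / a\<^sup>2 + 12 * M ^ 3 / a ^ 3) / L * (exp (- c * (L * y\<^sup>2)) * X ^ 3)"
    by simp
  also have "exp (- c * (L * y\<^sup>2)) * X ^ 3 = exp (- (c / 2 * L) * y\<^sup>2)"
    unfolding X_def exp_of_nat_mult[symmetric] exp_add[symmetric]
    by (rule arg_cong[of _ _ exp]) (simp add: a_def t_def algebra_simps)
  finally show ?thesis by (simp only: a_def)
qed

lemma sqrt_inverse_over_eq_powr:
  fixes L :: real
  assumes "L > 0"
  shows "1 / L * sqrt (1 / L) = L powr (- 3 / 2)"
proof -
  have "L powr (- 3 / 2) = L powr (- 1 + - (1 / 2))" by simp
  also have "\<dots> = 1 / L * sqrt (1 / L)"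
    using assms by (simp only: powr_add) (simp add: powr_minus powr_half_sqrt real_sqrt_divide field_simps)
  finally show ?thesis ..
qed

text \<open>
  Laplace's method with a relative error \<open>O(1 / L)\<close> and a constant that depends on the bounds
  \<open>c\<close>, \<open>M\<close> and on the size \<open>\<eta>\<close> of the plateau of the cutoff only. Cutoffs are Borel functions, to cover
  both smooth cutoffs and indicator functions. Because a cutoff is even, the odd terms of the expansion integrate to zero. This is what improves the error
  from \<open>L powr (- 1)\<close> to \<open>L powr (- 3 / 2)\<close>.
\<close>

lemma laplace_even_cutoff:
  fixes c M \<eta> \<rho> :: real
  assumes c: "c > 0" and M: "M \<ge> 0" and \<eta>: "\<eta> > 0" and \<rho>: "\<rho> \<le> 1" "2 * M * \<rho> \<le> c"
  obtains K where "K > 0"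
    and "\<And>L \<kappa> p g0 g1 \<psi> g chi. \<lbrakk>L > 0; Re \<kappa> \<ge> 4 * c; norm p \<le> M; norm g0 \<le> M; norm g1 \<le> M;
        \<And>y. \<bar>y\<bar> \<le> \<rho> \<Longrightarrow> norm (\<psi> y + \<kappa> / 2 * of_real y ^ 2 - p * of_real y ^ 3) \<le> M * y ^ 4;
        \<And>y. \<bar>y\<bar> \<le> \<rho> \<Longrightarrow> norm (g y - g0 - g1 * of_real y) \<le> M * y\<^sup>2;
        chi \<in> borel_measurable borel; \<And>y. chi (- y) = chi y; \<And>y. 0 \<le> chi y; \<And>y. chi y \<le> 1;
        \<And>y. \<bar>y\<bar> \<le> \<eta> \<Longrightarrow> chi y = 1; \<And>y. \<bar>y\<bar> > \<rho> \<Longrightarrow> chi y = 0;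
        (\<lambda>y. of_real (chi y) * (exp (of_real L * \<psi> y) * g y)) \<in> borel_measurable borel\<rbrakk>
      \<Longrightarrow> norm ((LBINT y. of_real (chi y) * (exp (of_real L * \<psi> y) * g y))
                - g0 * csqrt (of_real (2 * pi) / (of_real L * \<kappa>))) \<le> K * L powr (- 3 / 2)"
proof -
  define K1 where "K1 = M / (c / 6) + 5 * M\<^sup>2 / (c / 6)\<^sup>2 + 12 * M ^ 3 / (c / 6) ^ 3"
  define K2 where "K2 = M / (c * \<eta>\<^sup>2)"
  define K where "K = (K1 + K2) * sqrt (2 * pi / c) + 1"
  have K1: "K1 \<ge> 0" and K2: "K2 \<ge> 0"
    using c M unfolding K1_def K2_def by (auto intro!: add_nonneg_nonneg divide_nonneg_nonneg)
  show ?thesis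
  proof (rule that[of K])
    show "K > 0" unfolding K_def using K1 K2 c by (intro add_nonneg_pos mult_nonneg_nonneg) auto
  next
    fix L :: real and \<kappa> p g0 g1 :: complex and \<psi> g :: "real \<Rightarrow> complex" and chi :: "real \<Rightarrow> real"
    assume L: "L > 0" and \<kappa>: "Re \<kappa> \<ge> 4 * c" and pM: "norm p \<le> M" "norm g0 \<le> M" "norm g1 \<le> M"
      and \<psi>: "\<And>y. \<bar>y\<bar> \<le> \<rho> \<Longrightarrow> norm (\<psi> y + \<kappa> / 2 * of_real y ^ 2 - p * of_real y ^ 3) \<le> M * y ^ 4"
      and g: "\<And>y. \<bar>y\<bar> \<le> \<rho> \<Longrightarrow> norm (g y - g0 - g1 * of_real y) \<le> M * y\<^sup>2"
      and chi [measurable]: "chi \<in> borel_measurable borel"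
      and even: "\<And>y. chi (- y) = chi y" and chi01: "\<And>y. 0 \<le> chi y" "\<And>y. chi y \<le> 1"
      and chi1: "\<And>y. \<bar>y\<bar> \<le> \<eta> \<Longrightarrow> chi y = 1" and chi0: "\<And>y. \<bar>y\<bar> > \<rho> \<Longrightarrow> chi y = 0"
      and meas [measurable]: "(\<lambda>y. of_real (chi y) * (exp (of_real L * \<psi> y) * g y)) \<in> borel_measurable borel"
    define E where "E = (\<lambda>y. exp (- (of_real L * \<kappa>) * of_real (y\<^sup>2) / 2))"
    define Od where "Od = (\<lambda>y. of_real (chi y) * (E y * (g1 * of_real y + of_real L * g0 * p * of_real y ^ 3)))"
    define D where "D = (\<lambda>y. of_real (chi y) * (exp (of_real L * \<psi> y) * g y
                       - E y * (g0 + (g1 * of_real y + of_real L * g0 * p * of_real y ^ 3))))"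
    define R where "R = (\<lambda>y. of_real (1 - chi y) * (g0 * E y))"
    have [measurable]: "E \<in> borel_measurable borel" unfolding E_def by measurable
    have Dsplit: "D y = of_real (chi y) * (exp (of_real L * \<psi> y) * g y)
          - of_real (chi y) * (E y * (g0 + (g1 * of_real y + of_real L * g0 * p * of_real y ^ 3)))" for y
      by (simp add: D_def algebra_simps)
    have [measurable]: "D \<in> borel_measurable borel" unfolding Dsplit[abs_def] by measurable
    have [measurable]: "Od \<in> borel_measurable borel" unfolding Od_def by measurable
    have [measurable]: "R \<in> borel_measurable borel" unfolding R_def by measurable
    have c2: "c / 2 * L > 0" using c L by simp
    have En: "norm (E y) \<le> exp (- (c * L) * y\<^sup>2) * exp (- (c * L) * y\<^sup>2)" for y
    proof -
      have "4 * c * (L * y\<^sup>2) \<le> Re \<kappa> * (L * y\<^sup>2)" using \<kappa> L by (intro mult_right_mono) auto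
      then show ?thesis by (simp add: E_def field_simps flip: exp_add)
    qed
    have el: "exp (- (c * L) * y\<^sup>2) \<le> exp (- (c / 2 * L) * y\<^sup>2)" for y
    proof -
      have "- (c * L) * y\<^sup>2 \<le> - (c / 2 * L) * y\<^sup>2" using c L by (intro mult_right_mono) auto
      then show ?thesis by (simp only: exp_le_cancel_iff)
    qed
    have el1: "exp (- (c * L) * y\<^sup>2) \<le> 1" for y
      using c L by simp
    have En1: "norm (E y) \<le> exp (- (c / 2 * L) * y\<^sup>2)" for y
      using mult_mono[OF el[of y] el1[of y]] En[of y] by simp
    have Dn: "norm (D y) \<le> K1 / L * exp (- (c / 2 * L) * (y - 0)\<^sup>2)" for y
    proof (cases "\<bar>y\<bar> \<le> \<rho>")
      case True
      have y: "\<bar>y\<bar> \<le> 1" "2 * M * \<bar>y\<bar> \<le> c"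
        using True \<rho> mult_left_mono[OF True, of "2 * M"] M by auto
      have "norm (D y) \<le> 1 * (exp (- c * (L * y\<^sup>2)) * (M * y\<^sup>2 + 5 * M\<^sup>2 * L * y ^ 4 + 12 * M ^ 3 * L\<^sup>2 * y ^ 6))"
        unfolding D_def norm_mult E_def
        using chi01 laplace_integrand_expansion[OF L y \<kappa> \<psi>[OF True] g[OF True] pM]
        by (intro mult_mono) auto
      also have "\<dots> \<le> K1 / L * exp (- (c / 2 * L) * (y - 0)\<^sup>2)"
        using laplace_error_term_bound[OF c M L, of y] by (simp add: K1_def)
      finally show ?thesis .
    next
      case False
      then show ?thesis using chi0[of y] K1 L by (simp add: D_def)
    qed
    have Rn: "norm (R y) \<le> K2 / L * exp (- (c / 2 * L) * (y - 0)\<^sup>2)" for y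
    proof (cases "\<bar>y\<bar> \<le> \<eta>")
      case True
      then show ?thesis using chi1[of y] K2 L by (simp add: R_def)
    next
      case False
      have "exp (- (c * L) * y\<^sup>2) \<le> exp (- (c * L) * \<eta>\<^sup>2)"
      proof -
        have "\<eta>\<^sup>2 \<le> \<bar>y\<bar>\<^sup>2" using False \<eta> by (intro power_mono) auto
        then show ?thesis using c L by simp
      qed
      also have "\<dots> \<le> 1 / (c * L * \<eta>\<^sup>2)"
        using le_exp_over[of 1 "c * L * \<eta>\<^sup>2"] c L \<eta> by (simp add: exp_minus field_simps)
      finally have e: "exp (- (c * L) * y\<^sup>2) \<le> 1 / (c * L * \<eta>\<^sup>2)" .
      have "norm (R y) \<le> 1 * (M * (exp (- (c / 2 * L) * y\<^sup>2) * (1 / (c * L * \<eta>\<^sup>2))))"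
        unfolding R_def norm_mult norm_of_real
      proof (intro mult_mono)
        show "norm (E y) \<le> exp (- (c / 2 * L) * y\<^sup>2) * (1 / (c * L * \<eta>\<^sup>2))"
          using En[of y] mult_mono[OF el[of y] e] by simp
      qed (use chi01[of y] pM M in auto)
      then show ?thesis by (simp add: K2_def field_simps)
    qed
    have On: "norm (Od y) \<le> (M + L * (M * M)) * exp (- (c / 2 * L) * (y - 0)\<^sup>2)" for y
    proof (cases "\<bar>y\<bar> \<le> \<rho>")
      case True
      then have y: "\<bar>y\<bar> \<le> 1" using \<rho> by simp
      have "norm (g1 * of_real y) \<le> M * 1" unfolding norm_mult using y pM M by (intro mult_mono) auto
      moreover have "norm (of_real L * g0 * p * of_real y ^ 3) \<le> L * M * M * 1"
        unfolding norm_mult norm_power norm_of_real using y pM M L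
        by (intro mult_mono) (auto intro: power_le_one)
      ultimately have "norm (g1 * of_real y + of_real L * g0 * p * of_real y ^ 3) \<le> M + L * (M * M)"
        using norm_triangle_ineq[of "g1 * of_real y" "of_real L * g0 * p * of_real y ^ 3"] by simp
      then have "norm (Od y) \<le> 1 * (exp (- (c / 2 * L) * y\<^sup>2) * (M + L * (M * M)))"
        unfolding Od_def norm_mult using chi01[of y] En1[of y] M L by (intro mult_mono) auto
      then show ?thesis by (simp add: mult.commute)
    next
      case False
      then show ?thesis using chi0[of y] M L by (simp add: Od_def)
    qed
    have D: "integrable lborel D" "norm (LBINT y. D y) \<le> K1 / L * sqrt (pi / (c / 2 * L))"
      using integral_dominated_by_gaussian[OF c2 _ Dn] by auto
    have R: "integrable lborel R" "norm (LBINT y. R y) \<le> K2 / L * sqrt (pi / (c / 2 * L))"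
      using integral_dominated_by_gaussian[OF c2 _ Rn] by auto
    have Od: "integrable lborel Od" using integral_dominated_by_gaussian[OF c2 _ On] by auto
    have Od0: "(LBINT y. Od y) = 0"
      by (rule integral_odd_eq_0) (simp add: Od_def E_def even algebra_simps)
    have Ehb: "has_bochner_integral lborel E (csqrt (of_real (2 * pi) / (of_real L * \<kappa>)))"
      unfolding E_def using L \<kappa> c by (intro has_bochner_integral_complex_gaussian) auto
    then have Eint: "integrable lborel E" "(LBINT y. E y) = csqrt (of_real (2 * pi) / (of_real L * \<kappa>))"
      by (auto simp: has_bochner_integral_iff)
    \<comment> \<open>\<open>D\<close> is the error of the expansion, \<open>Od\<close> its odd part, and \<open>R\<close> the part of the Gaussian
      that the cutoff removes.\<close>
    have "(\<lambda>y. of_real (chi y) * (exp (of_real L * \<psi> y) * g y)) = (\<lambda>y. D y + Od y + (g0 * E y - R y))"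
      by (auto simp: Dsplit Od_def R_def algebra_simps)
    then have "(LBINT y. of_real (chi y) * (exp (of_real L * \<psi> y) * g y))
        = (LBINT y. D y) + (LBINT y. Od y) + (g0 * (LBINT y. E y) - (LBINT y. R y))"
      using D(1) R(1) Od Eint(1) by simp
    then have "norm ((LBINT y. of_real (chi y) * (exp (of_real L * \<psi> y) * g y))
                - g0 * csqrt (of_real (2 * pi) / (of_real L * \<kappa>))) \<le> norm (LBINT y. D y) + norm (LBINT y. R y)"
      using norm_triangle_ineq4[of "LBINT y. D y" "LBINT y. R y"] by (simp add: Od0 Eint(2))
    also have "\<dots> \<le> (K1 + K2) / L * sqrt (pi / (c / 2 * L))"
      using D(2) R(2) by (simp add: add_divide_distrib ring_distribs)
    also have "\<dots> = (K1 + K2) * sqrt (2 * pi / c) * (1 / L * sqrt (1 / L))"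
      using c L by (simp add: real_sqrt_divide real_sqrt_mult field_simps)
    also have "1 / L * sqrt (1 / L) = L powr (- 3 / 2)" by (rule sqrt_inverse_over_eq_powr[OF L])
    also have "(K1 + K2) * sqrt (2 * pi / c) * L powr (- 3 / 2) \<le> K * L powr (- 3 / 2)"
      by (intro mult_right_mono) (auto simp: K_def)
    finally show "norm ((LBINT y. of_real (chi y) * (exp (of_real L * \<psi> y) * g y))
                - g0 * csqrt (of_real (2 * pi) / (of_real L * \<kappa>))) \<le> K * L powr (- 3 / 2)" .
  qed
qed

section \<open>The right lower saddle\<close>

text \<open>
  The point \<open>u - \<i> v\<close> is the right lower saddle for \<open>\<delta>\<close>: the assumptions are the real and imaginary
  parts of \<open>w (w\<^sup>2 + \<delta>\<^sup>2) = - \<i>\<close>, with the first one divided by \<open>u\<close> and used to eliminate \<open>u\<close> from the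
  second one. All bounds of this locale are absolute; the distance of \<open>\<delta>\<close> to its critical
  value enters only through \<open>u\<close>.
\<close>

locale lower_saddle =
  fixes \<delta> u v :: real
  assumes \<delta>_nonneg: "0 \<le> \<delta>" and u_pos: "0 < u" and v_pos: "0 < v"
    and Im_eq: "8 * v ^ 3 - 2 * v * \<delta>\<^sup>2 = 1" and Re_eq: "u\<^sup>2 = 3 * v\<^sup>2 - \<delta>\<^sup>2"
begin

lemma norm_eq: "2 * v * (u\<^sup>2 + v\<^sup>2) = 1"
proof -
  have "2 * v * (u\<^sup>2 + v\<^sup>2) = 8 * v ^ 3 - 2 * v * \<delta>\<^sup>2"
    unfolding Re_eq by (simp add: algebra_simps power2_eq_square power3_eq_cube)
  then show ?thesis using Im_eq by simp
qed

lemma v_ge: "1 / 2 \<le> v"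
proof (rule ccontr)
  assume "\<not> 1 / 2 \<le> v"
  then have "v ^ 3 < (1 / 2) ^ 3" using v_pos by (intro power_strict_mono) auto
  moreover have "0 \<le> 2 * v * \<delta>\<^sup>2" using v_pos by simp
  ultimately show False using Im_eq by (simp add: power3_eq_cube)
qed

lemma v_less_1: "v < 1"
proof (rule ccontr)
  assume "\<not> v < 1"
  then have "1 \<le> v" by simp
  then have "1 \<le> v\<^sup>2" by (rule one_le_power)
  then have "1 \<le> u\<^sup>2 + v\<^sup>2" using zero_le_power2[of u] by linarith
  then have "1 * 1 \<le> v * (u\<^sup>2 + v\<^sup>2)" using \<open>1 \<le> v\<close> by (intro mult_mono) auto
  then show False using norm_eq by simp
qed

lemma u_le_1: "u \<le> 1"
proof -
  have "1 * (u\<^sup>2 + v\<^sup>2) \<le> 2 * v * (u\<^sup>2 + v\<^sup>2)"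
    using v_ge by (intro mult_right_mono) auto
  then have "u\<^sup>2 + v\<^sup>2 \<le> 1" by (simp only: norm_eq mult_1)
  then have "u\<^sup>2 \<le> 1" using zero_le_power2[of v] by linarith
  then show ?thesis using u_pos by (simp add: abs_square_le_1)
qed

lemma \<delta>_less_2: "\<delta> < 2"
proof -
  have "v\<^sup>2 \<le> 1" using v_less_1 v_pos by (simp add: abs_square_le_1)
  then have "\<delta>\<^sup>2 < 2\<^sup>2" using Re_eq u_pos zero_less_power[of u 2] by simp
  then show ?thesis by (rule power_less_imp_less_base) simp
qed

definition w0 :: complex where "w0 = Complex u (- v)"

text \<open>
  The value of \<open>w\<^sup>2 + \<delta>\<^sup>2\<close> at the saddle.
\<close>

definition A :: complex where "A = w0\<^sup>2 + of_real (\<delta>\<^sup>2)"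

text \<open>
  This is \<open>- \<Phi>''\<close> at the saddle, in the form that the expansion of \<open>\<Phi>'\<close> produces.
\<close>

definition \<kappa> :: complex where "\<kappa> = 2 + 4 * w0\<^sup>2 / A"

lemma stationary: "w0 * A = - \<i>"
proof (rule complex_eqI)
  have "Re (w0 * A) = u * (u\<^sup>2 - (3 * v\<^sup>2 - \<delta>\<^sup>2))"
    by (simp add: A_def w0_def power2_eq_square power3_eq_cube algebra_simps)
  then show "Re (w0 * A) = Re (- \<i>)" using Re_eq by simp
  have "Im (w0 * A) = v * (v\<^sup>2 - \<delta>\<^sup>2 - 3 * u\<^sup>2)"
    by (simp add: A_def w0_def power2_eq_square power3_eq_cube algebra_simps)
  also have "\<dots> = - (8 * v ^ 3 - 2 * v * \<delta>\<^sup>2)"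
    unfolding Re_eq by (simp add: power2_eq_square power3_eq_cube algebra_simps)
  finally show "Im (w0 * A) = Im (- \<i>)" using Im_eq by simp
qed

lemma A_nz: "A \<noteq> 0"
  using stationary by auto

lemma norm_w0_sq: "(norm w0)\<^sup>2 = 1 / (2 * v)"
  using norm_eq v_pos unfolding cmod_power2 by (simp add: w0_def field_simps)

lemma norm_w0_A: "norm w0 * norm A = 1"
  using arg_cong[OF stationary, of norm] by (simp add: norm_mult)

lemma norm_A_sq: "(norm A)\<^sup>2 = 2 * v"
proof -
  have "(norm w0)\<^sup>2 * (norm A)\<^sup>2 = 1"
    using norm_w0_A by (metis power_mult_distrib power_one)
  then show ?thesis using v_pos by (simp add: norm_w0_sq field_simps)
qed

lemma norm_w0_le: "norm w0 \<le> 1" and norm_A_ge: "1 \<le> norm A" and norm_A_le: "norm A \<le> 2"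
proof -
  have "(norm w0)\<^sup>2 \<le> 1\<^sup>2" using v_ge by (simp add: norm_w0_sq field_simps)
  then show "norm w0 \<le> 1" by (rule power2_le_imp_le) simp
  have "1\<^sup>2 \<le> (norm A)\<^sup>2" using v_ge by (simp add: norm_A_sq)
  then show "1 \<le> norm A" by (rule power2_le_imp_le) simp
  have "(norm A)\<^sup>2 \<le> 2\<^sup>2" using v_less_1 by (simp add: norm_A_sq)
  then show "norm A \<le> 2" by (rule power2_le_imp_le) simp
qed

lemma \<kappa>_eq: "\<kappa> = 6 - 4 * \<i> * of_real (\<delta>\<^sup>2) * w0"
proof -
  have "\<i> * w0 * A = 1" using stationary by (simp add: mult.assoc)
  then have "1 / A = \<i> * w0" using A_nz by (simp add: field_simps)
  moreover have "\<kappa> = 2 + 4 * w0\<^sup>2 * (1 / A)" by (simp add: \<kappa>_def)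
  ultimately have "\<kappa> = 2 + 4 * w0\<^sup>2 * (\<i> * w0)" by simp
  also have "w0\<^sup>2 = A - of_real (\<delta>\<^sup>2)" by (simp add: A_def)
  also have "2 + 4 * (A - of_real (\<delta>\<^sup>2)) * (\<i> * w0) = 2 + 4 * \<i> * (w0 * A) - 4 * \<i> * of_real (\<delta>\<^sup>2) * w0"
    by (simp add: algebra_simps)
  also have "4 * \<i> * (w0 * A) = 4" unfolding stationary by (simp add: complex_eq_iff)
  finally show ?thesis by simp
qed

text \<open>
  The saddle is nondegenerate, with a quantitative bound, as long as \<open>u\<close> stays away from \<open>0\<close>; in
  particular the principal square root of \<open>1 / \<kappa>\<close> never meets its branch cut.
\<close>

lemma Re_\<kappa>: "Re \<kappa> = 16 * v * u\<^sup>2"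
proof -
  have "Re \<kappa> = 6 - 4 * \<delta>\<^sup>2 * v" by (simp add: \<kappa>_eq w0_def)
  also have "\<dots> = 6 * (8 * v ^ 3 - 2 * v * \<delta>\<^sup>2) - 4 * \<delta>\<^sup>2 * v" using Im_eq by simp
  also have "\<dots> = 16 * v * (3 * v\<^sup>2 - \<delta>\<^sup>2)" by (simp add: power2_eq_square power3_eq_cube algebra_simps)
  finally show ?thesis using Re_eq by simp
qed

lemma Re_\<kappa>_ge: "8 * u\<^sup>2 \<le> Re \<kappa>"
  unfolding Re_\<kappa> using v_ge by (intro mult_right_mono) auto

lemma Re_\<kappa>_pos: "Re \<kappa> > 0"
  unfolding Re_\<kappa> using u_pos v_pos by simp

lemma norm_\<kappa>_le: "norm \<kappa> \<le> 6"
proof -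
  have "norm (w0\<^sup>2 / A) \<le> 1"
    using norm_w0_le norm_A_ge A_nz by (simp add: norm_divide norm_power field_simps) (meson norm_ge_zero order_trans power_le_one)
  then show ?thesis
    unfolding \<kappa>_def using norm_triangle_ineq[of 2 "4 * w0\<^sup>2 / A"] by (simp add: norm_divide norm_mult)
qed

lemma phase''_w0: "phase'' \<delta> w0 = - \<kappa>"
proof -
  have "phase'' \<delta> w0 = -2 + 4 * \<i> * w0 / A\<^sup>2"
    using u_pos \<delta>_nonneg by (subst phase''_eq) (auto simp: A_def w0_def)
  also have "\<i> = - (w0 * A)" by (simp add: stationary)
  finally show ?thesis using A_nz by (simp add: \<kappa>_def power2_eq_square)
qed

end

lemma lower_saddle_iff:
  assumes "0 \<le> \<delta>" "0 < u" "0 < v"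
  shows "lower_saddle \<delta> u v \<longleftrightarrow> Complex u (- v) * ((Complex u (- v))\<^sup>2 + of_real (\<delta>\<^sup>2)) = - \<i>"
proof
  assume "lower_saddle \<delta> u v"
  then show "Complex u (- v) * ((Complex u (- v))\<^sup>2 + of_real (\<delta>\<^sup>2)) = - \<i>"
    using lower_saddle.stationary lower_saddle.A_def lower_saddle.w0_def by metis
next
  let ?E = "Complex u (- v) * ((Complex u (- v))\<^sup>2 + of_real (\<delta>\<^sup>2))"
  assume E: "?E = - \<i>"
  have "Re ?E = u * (u\<^sup>2 - (3 * v\<^sup>2 - \<delta>\<^sup>2))"
    by (simp add: power2_eq_square power3_eq_cube algebra_simps)
  then have "0 = u * (u\<^sup>2 - (3 * v\<^sup>2 - \<delta>\<^sup>2))" unfolding E by simp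
  then have R: "u\<^sup>2 = 3 * v\<^sup>2 - \<delta>\<^sup>2" using assms by simp
  have "Im ?E = v * (v\<^sup>2 - \<delta>\<^sup>2 - 3 * u\<^sup>2)"
    by (simp add: power2_eq_square power3_eq_cube algebra_simps)
  also have "\<dots> = - (8 * v ^ 3 - 2 * v * \<delta>\<^sup>2)"
    unfolding R by (simp add: power2_eq_square power3_eq_cube algebra_simps)
  finally have "8 * v ^ 3 - 2 * v * \<delta>\<^sup>2 = 1" unfolding E by simp
  then show "lower_saddle \<delta> u v" using assms R by unfold_locales auto
qed

text \<open>
  Subtracting the two cubic equations for the heights leaves \<open>(v - v') * c = 2 v' (\<delta>\<^sup>2 - \<delta>'\<^sup>2)\<close> with \<open>c\<close>
  bounded below. This one estimate gives both the uniqueness of the saddle and its continuity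
  in \<open>\<delta>\<close>.
\<close>

lemma lower_saddle_height_lipschitz:
  assumes "lower_saddle \<delta> u v" "lower_saddle \<delta>' u' v'"
  shows "\<bar>v - v'\<bar> \<le> \<bar>\<delta>\<^sup>2 - \<delta>'\<^sup>2\<bar>"
proof -
  interpret a: lower_saddle \<delta> u v by fact
  interpret b: lower_saddle \<delta>' u' v' by fact
  define c where "c = 8 * (v\<^sup>2 + v * v' + v'\<^sup>2) - 2 * \<delta>\<^sup>2"
  have "(v - v') * c = (8 * v ^ 3 - 2 * v * \<delta>\<^sup>2) - (8 * v' ^ 3 - 2 * v' * \<delta>'\<^sup>2) + 2 * v' * (\<delta>\<^sup>2 - \<delta>'\<^sup>2)"
    by (simp add: c_def power2_eq_square power3_eq_cube algebra_simps)
  then have eq: "(v - v') * c = 2 * v' * (\<delta>\<^sup>2 - \<delta>'\<^sup>2)" using a.Im_eq b.Im_eq by simp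
  \<comment> \<open>The equation of the height gives \<open>8 v\<^sup>2 - 2 \<delta>\<^sup>2 = 1 / v > 0\<close>, and \<open>8 v'\<^sup>2 \<ge> 2\<close> is left for \<open>c\<close>.\<close>
  have "v * (8 * v\<^sup>2 - 2 * \<delta>\<^sup>2) = 1"
    using a.Im_eq by (simp add: power2_eq_square power3_eq_cube algebra_simps)
  then have "8 * v\<^sup>2 - 2 * \<delta>\<^sup>2 > 0" using a.v_pos by (metis zero_less_mult_pos zero_less_one)
  moreover have "1 / 4 \<le> v'\<^sup>2" using power_mono[OF b.v_ge, of 2] by (simp add: power2_eq_square)
  moreover have "v * v' > 0" using a.v_pos b.v_pos by simp
  ultimately have c: "c \<ge> 2" unfolding c_def by simp
  have "\<bar>v - v'\<bar> * 2 \<le> \<bar>v - v'\<bar> * c" using c by (intro mult_left_mono) auto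
  also have "\<dots> = 2 * v' * \<bar>\<delta>\<^sup>2 - \<delta>'\<^sup>2\<bar>" using eq c b.v_pos by (metis abs_mult abs_of_pos less_le_trans mult_2 pos_add_strict zero_less_numeral)
  also have "\<dots> \<le> 2 * \<bar>\<delta>\<^sup>2 - \<delta>'\<^sup>2\<bar>" using b.v_less_1 b.v_pos by (intro mult_right_mono) auto
  finally show ?thesis by simp
qed

lemma (in lower_saddle) saddle_eq: "saddle \<delta> = w0"
  unfolding saddle_def
proof (rule the_equality)
  show "w0 * (w0\<^sup>2 + of_real (\<delta>\<^sup>2)) = - \<i> \<and> Im w0 < 0 \<and> Re w0 > 0"
    using stationary u_pos v_pos by (simp add: A_def w0_def)
next
  fix w :: complex
  assume w: "w * (w\<^sup>2 + of_real (\<delta>\<^sup>2)) = - \<i> \<and> Im w < 0 \<and> Re w > 0"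
  then have *: "lower_saddle \<delta> (Re w) (- Im w)"
    using \<delta>_nonneg by (subst lower_saddle_iff) auto
  then have "v = - Im w"
    using lower_saddle_height_lipschitz[OF _ *] lower_saddle_axioms by fastforce
  moreover have "(Re w)\<^sup>2 = u\<^sup>2"
    using lower_saddle.Re_eq[OF *] Re_eq \<open>v = - Im w\<close> by simp
  then have "Re w = u" using w u_pos by (simp add: power2_eq_iff_nonneg)
  ultimately show "w = w0" unfolding w0_def by (simp add: complex_eq_iff)
qed

lemma delta_c_cubed: "delta_c ^ 3 = 3 * sqrt 3 / 2"
  by (simp add: delta_c_def alpha_c_def)

lemma delta_c_pos: "delta_c > 0"
  by (simp add: delta_c_def alpha_c_def)

text \<open>
  At the height \<open>v = \<delta> / sqrt 3\<close>, where \<open>u\<close> would vanish, \<open>8 v\<^sup>3 - 2 v \<delta>\<^sup>2\<close> equals \<open>(\<delta> / delta_c)\<^sup>3 < 1\<close>. So the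
  equation of the height has a root above it: the critical value is exactly where the
  two lower saddles collide on the imaginary axis.
\<close>

lemma ex_lower_saddle:
  assumes "0 \<le> \<delta>" "\<delta> < delta_c"
  shows "\<exists>u v. lower_saddle \<delta> u v"
proof -
  define f where "f = (\<lambda>v. 8 * v ^ 3 - 2 * v * \<delta>\<^sup>2)"
  define l where "l = \<delta> / sqrt 3"
  have l2: "l\<^sup>2 = \<delta>\<^sup>2 / 3" by (simp add: l_def power_divide)
  have l0: "l \<ge> 0" using assms by (simp add: l_def)
  have d3: "\<delta> ^ 3 < 3 * sqrt 3 / 2"
    using power_strict_mono[OF assms(2,1), of 3] by (simp add: delta_c_cubed)
  have "f l = 2 * l * (4 * l\<^sup>2 - \<delta>\<^sup>2)" by (simp add: f_def power2_eq_square power3_eq_cube algebra_simps)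
  also have "\<dots> = 2 * \<delta> ^ 3 / (3 * sqrt 3)"
    unfolding l2 by (simp add: l_def power2_eq_square power3_eq_cube)
  also have "\<dots> < 1" using d3 by (simp add: field_simps)
  finally have fl: "f l < 1" .
  have "\<delta> < 2"
  proof -
    have "sqrt 3 \<le> sqrt 4" by (intro real_sqrt_le_mono) auto
    then have "\<delta> ^ 3 < 2 ^ 3" using d3 by simp
    then show ?thesis by (rule power_less_imp_less_base) simp
  qed
  have l2': "l \<le> 2"
  proof (rule power2_le_imp_le)
    show "l\<^sup>2 \<le> 2\<^sup>2" using power_mono[of \<delta> 2 2] assms \<open>\<delta> < 2\<close> by (simp add: l2)
  qed simp
  have "\<delta>\<^sup>2 \<le> 4" using power_mono[of \<delta> 2 2] assms \<open>\<delta> < 2\<close> by simp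
  then have f2: "f 2 \<ge> 1" by (simp add: f_def)
  have "\<exists>v\<ge>l. v \<le> 2 \<and> f v = 1"
    using fl f2 l2' by (intro IVT') (auto simp: f_def intro!: continuous_intros)
  then obtain v where v: "l \<le> v" "f v = 1" by auto
  have "v \<noteq> l" using v fl by auto
  with v l0 have lv: "l < v" and v0: "0 < v" by auto
  have "\<delta>\<^sup>2 / 3 < v\<^sup>2" using power_strict_mono[OF lv l0, of 2] by (simp add: l2)
  then have "lower_saddle \<delta> (sqrt (3 * v\<^sup>2 - \<delta>\<^sup>2)) v"
    using v v0 assms by unfold_locales (auto simp: f_def)
  then show ?thesis by blast
qed

lemma lower_saddle_saddle:
  assumes "0 \<le> \<delta>" "\<delta> < delta_c"
  shows "lower_saddle \<delta> (Re (saddle \<delta>)) (- Im (saddle \<delta>))"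
proof -
  obtain u v where uv: "lower_saddle \<delta> u v" using ex_lower_saddle[OF assms] by blast
  then show ?thesis using lower_saddle.saddle_eq[OF uv] lower_saddle.w0_def[OF uv] by simp
qed

lemma continuous_on_saddle: "continuous_on {0..<delta_c} saddle"
proof -
  have "continuous_on {0..<delta_c} (\<lambda>d. Im (saddle d))"
  proof (unfold continuous_on_def, rule ballI)
    fix d assume d: "d \<in> {0..<delta_c}"
    have "((\<lambda>x. \<bar>x\<^sup>2 - d\<^sup>2\<bar>) \<longlongrightarrow> \<bar>d\<^sup>2 - d\<^sup>2\<bar>) (at d within {0..<delta_c})"
      by (intro tendsto_intros)
    then have lim: "((\<lambda>x. \<bar>x\<^sup>2 - d\<^sup>2\<bar>) \<longlongrightarrow> 0) (at d within {0..<delta_c})" by simp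
    have "\<bar>Im (saddle x) - Im (saddle d)\<bar> \<le> \<bar>x\<^sup>2 - d\<^sup>2\<bar>" if "x \<in> {0..<delta_c}" for x
      using lower_saddle_height_lipschitz[OF lower_saddle_saddle[of x] lower_saddle_saddle[of d]] that d by auto
    then have "((\<lambda>x. Im (saddle x) - Im (saddle d)) \<longlongrightarrow> 0) (at d within {0..<delta_c})"
      using lim by (intro Lim_null_comparison[OF _ lim]) (auto simp: eventually_at_filter)
    then show "((\<lambda>x. Im (saddle x)) \<longlongrightarrow> Im (saddle d)) (at d within {0..<delta_c})"
      by (rule LIM_zero_cancel)
  qed
  note cIm = this
  have Re: "Re (saddle d) = sqrt (3 * (Im (saddle d))\<^sup>2 - d\<^sup>2)" if "d \<in> {0..<delta_c}" for d
  proof -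
    interpret lower_saddle d "Re (saddle d)" "- Im (saddle d)" using that by (intro lower_saddle_saddle) auto
    show ?thesis using Re_eq u_pos by (intro real_sqrt_unique[symmetric]) auto
  qed
  have "continuous_on {0..<delta_c} (\<lambda>d. Complex (sqrt (3 * (Im (saddle d))\<^sup>2 - d\<^sup>2)) (Im (saddle d)))"
    unfolding Complex_eq by (intro continuous_intros cIm)
  then show ?thesis
    by (rule continuous_on_eq) (simp flip: Re)
qed

lemma Re_of_real_divide_pos:
  assumes "t > 0" "Re z > 0"
  shows "Re (of_real t / z) > 0"
  using assms by (auto simp: Re_divide intro!: divide_pos_pos add_pos_nonneg)

text \<open>
  Since \<open>Re \<kappa> > 0\<close>, the principal square root is a continuous branch that is positive at \<open>\<delta> = 0\<close>, where
  \<open>\<kappa> = 6\<close>. The quotient of any other branch by this one is continuous with values \<open>\<plusminus> 1\<close>, hence constant, and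
  equals \<open>1\<close> at \<open>\<delta> = 0\<close>.
\<close>

lemma saddle_sqrt_eq_csqrt:
  assumes L: "L > 0" and d: "d \<in> {0..<delta_c}"
  shows "saddle_sqrt L d = csqrt (of_real (2 * pi) / (- of_real L * phase'' d (saddle d)))"
proof -
  let ?D = "{0..<delta_c}"
  define R where "R = (\<lambda>d. of_real (2 * pi) / (- of_real L * phase'' d (saddle d)))"
  have nz: "(saddle x)\<^sup>2 + of_real (x\<^sup>2) \<noteq> 0" and Req: "Re (saddle x) \<noteq> 0"
    and pos: "Re (- of_real L * phase'' x (saddle x)) > 0" if "x \<in> ?D" for x
  proof -
    interpret lower_saddle x "Re (saddle x)" "- Im (saddle x)" using that by (intro lower_saddle_saddle) auto
    have w0: "w0 = saddle x" by (simp add: w0_def)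
    show "(saddle x)\<^sup>2 + of_real (x\<^sup>2) \<noteq> 0" using A_nz unfolding A_def w0 .
    show "Re (saddle x) \<noteq> 0" using u_pos by simp
    have "phase'' x (saddle x) = - \<kappa>" using phase''_w0 unfolding w0 .
    then show "Re (- of_real L * phase'' x (saddle x)) > 0" using Re_\<kappa>_pos L by simp
  qed
  have Rpos: "Re (R x) > 0" if "x \<in> ?D" for x
    unfolding R_def by (intro Re_of_real_divide_pos pos[OF that]) simp
  have contP: "continuous_on ?D (\<lambda>x. phase'' x (saddle x))"
  proof -
    have "continuous_on ?D (\<lambda>x. -2 + 4 * \<i> * saddle x / ((saddle x)\<^sup>2 + of_real (x\<^sup>2))\<^sup>2)"
      using nz by (intro continuous_intros continuous_on_saddle) auto
    then show ?thesis
      by (rule continuous_on_eq) (simp add: phase''_eq Req)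
  qed
  have contR: "continuous_on ?D R"
    unfolding R_def using pos by (intro continuous_intros contP) fastforce
  have notneg: "R x \<notin> \<real>\<^sub>\<le>\<^sub>0" if "x \<in> ?D" for x
    using Rpos[OF that] by (auto simp: complex_nonpos_Reals_iff)
  have contS: "continuous_on ?D (\<lambda>x. csqrt (R x))"
    by (rule continuous_on_compose2[OF continuous_on_csqrt contR]) (use notneg in auto)
  have Snz: "csqrt (R x) \<noteq> 0" if "x \<in> ?D" for x using Rpos[OF that] by auto
  have z: "0 \<in> ?D" using delta_c_pos by simp
  have R0: "R 0 = of_real (2 * pi / (L * 6))"
  proof -
    interpret lower_saddle 0 "Re (saddle 0)" "- Im (saddle 0)" using z by (intro lower_saddle_saddle) auto
    have "w0 = saddle 0" by (simp add: w0_def)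
    then have "phase'' 0 (saddle 0) = - \<kappa>" using phase''_w0 by simp
    then show ?thesis by (simp add: R_def \<kappa>_eq)
  qed
  have S0: "csqrt (R 0) = of_real (sqrt (2 * pi / (L * 6)))"
    unfolding R0 using L by (subst of_real_sqrt) auto
  have sq: "(csqrt (R x))\<^sup>2 = of_real (2 * pi) / (- of_real L * phase'' x (saddle x))" for x
    unfolding R_def by (rule power2_csqrt)
  have "is_sqrt_branch L (\<lambda>x. csqrt (R x))"
    unfolding is_sqrt_branch_def using L by (intro conjI ballI contS sq) (auto simp: S0)
  then have br: "is_sqrt_branch L (saddle_sqrt L)"
    unfolding saddle_sqrt_def by (rule someI[of "is_sqrt_branch L"])
  define q where "q = (\<lambda>x. saddle_sqrt L x / csqrt (R x))"
  have "q constant_on ?D"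
  proof (rule continuous_finite_range_constant)
    show "connected ?D" by (rule convex_connected) simp
    show "continuous_on ?D q"
      unfolding q_def using br contS Snz by (intro continuous_intros) (auto simp: is_sqrt_branch_def)
    have "q x \<in> {1, -1}" if "x \<in> ?D" for x
    proof -
      have "(saddle_sqrt L x)\<^sup>2 = R x" using br that unfolding is_sqrt_branch_def R_def by blast
      then have "(q x)\<^sup>2 = 1\<^sup>2" using Snz[OF that] by (simp add: q_def power_divide)
      then show ?thesis by (simp only: power2_eq_iff) auto
    qed
    then show "finite (q ` ?D)" by (meson finite.emptyI finite.insertI finite_subset image_subsetI)
  qed
  then have "q d = q 0" using d z unfolding constant_on_def by metis
  moreover have "q 0 = 1"
  proof -
    obtain t where t: "saddle_sqrt L 0 = of_real t" "t > 0"
      using br unfolding is_sqrt_branch_def by (metis Re_complex_of_real Reals_cases)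
    have "(saddle_sqrt L 0)\<^sup>2 = R 0" using br z unfolding is_sqrt_branch_def R_def by blast
    then have "csqrt (R 0) = saddle_sqrt L 0" using t by (intro csqrt_unique) auto
    then show ?thesis using Snz[OF z] by (simp add: q_def)
  qed
  ultimately show ?thesis using Snz[OF d] by (simp add: q_def R_def field_simps)
qed

section \<open>The integrand near the saddle and on the line through it\<close>

lemma has_field_derivative_phase:
  assumes "\<delta> \<ge> 0" "Re z > 0"
  shows "(phase \<delta> has_field_derivative (- 2 * z - 2 * \<i> / (z\<^sup>2 + of_real (\<delta>\<^sup>2)))) (at z)"
proof (cases "\<delta> = 0")
  case True
  have "z \<noteq> 0" using assms by auto
  then show ?thesis
    unfolding phase_def using True by (auto intro!: derivative_eq_intros simp: power2_eq_square)
next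
  case False
  then have d: "\<delta> > 0" using assms by simp
  define p where "p = z + \<i> * of_real \<delta>"
  define q where "q = z - \<i> * of_real \<delta>"
  have pq: "p \<noteq> 0" "q \<noteq> 0" using assms by (auto simp: p_def q_def complex_eq_iff)
  have cut: "p / q \<notin> \<real>\<^sub>\<le>\<^sub>0"
  proof
    assume "p / q \<in> \<real>\<^sub>\<le>\<^sub>0"
    then obtain t where t: "p / q = of_real t" "t \<le> 0" by (auto elim!: nonpos_Reals_cases)
    then have "p = of_real t * q" using pq by (simp add: field_simps)
    then have "Re p = t * Re q" by simp
    then have "Re z = t * Re z" by (simp add: p_def q_def)
    then show False using t(2) assms(2) mult_nonpos_nonneg[of t "Re z"] by linarith
  qed
  have dLn: "((\<lambda>w. Ln ((w + \<i> * of_real \<delta>) / (w - \<i> * of_real \<delta>))) has_field_derivative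
          (1 / (p / q) * ((q - p) / q\<^sup>2))) (at z)"
    using pq cut unfolding p_def q_def
    by (auto intro!: derivative_eq_intros simp: power2_eq_square)
  have "((\<lambda>w. - w\<^sup>2 + Ln ((w + \<i> * of_real \<delta>) / (w - \<i> * of_real \<delta>)) / of_real \<delta>) has_field_derivative
          (- (2 * z) + (1 / (p / q) * ((q - p) / q\<^sup>2)) / of_real \<delta>)) (at z)"
    by (intro DERIV_add DERIV_cdivide dLn) (auto intro!: derivative_eq_intros)
  also have "(\<lambda>w. - w\<^sup>2 + Ln ((w + \<i> * of_real \<delta>) / (w - \<i> * of_real \<delta>)) / of_real \<delta>) = phase \<delta>"
    using False by (auto simp: phase_def)
  also have "1 / (p / q) * ((q - p) / q\<^sup>2) / of_real \<delta> = - 2 * \<i> / (p * q)"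
  proof -
    have "q - p = - 2 * \<i> * of_real \<delta>" by (simp add: p_def q_def)
    then show ?thesis using pq d by (simp add: power2_eq_square)
  qed
  also have "p * q = z\<^sup>2 + of_real (\<delta>\<^sup>2)" by (simp add: p_def q_def algebra_simps power2_eq_square)
  finally show ?thesis by simp
qed

context lower_saddle
begin

text \<open>
  The value of \<open>w\<^sup>2 + \<delta>\<^sup>2\<close> on the horizontal line through the saddle, at the signed distance \<open>y\<close> from it.
\<close>

definition B :: "real \<Rightarrow> complex" where "B y = (w0 + of_real y)\<^sup>2 + of_real (\<delta>\<^sup>2)"

lemma B_eq: "B y = A + 2 * w0 * of_real y + (of_real y)\<^sup>2"
  by (simp add: B_def A_def power2_eq_square algebra_simps)

lemma norm_B_ge:
  assumes "\<bar>y\<bar> \<le> 1 / 8"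
  shows "1 / 2 \<le> norm (B y)"
proof -
  have "norm (2 * w0 * of_real y + (of_real y)\<^sup>2) \<le> norm (2 * w0 * of_real y) + norm ((of_real y)\<^sup>2 :: complex)"
    by (rule norm_triangle_ineq)
  also have "norm (2 * w0 * of_real y) \<le> 2 * 1 * (1 / 8)"
    unfolding norm_mult using norm_w0_le assms by (intro mult_mono) auto
  also have "norm ((of_real y)\<^sup>2 :: complex) \<le> (1 / 8)\<^sup>2"
    unfolding norm_power using assms by (intro power_mono) auto
  finally have "norm (2 * w0 * of_real y + (of_real y)\<^sup>2) \<le> 1 / 2" by (simp add: power2_eq_square)
  then show ?thesis
    using norm_diff_ineq[of A "2 * w0 * of_real y + (of_real y)\<^sup>2"] norm_A_ge
    unfolding B_eq add.assoc by linarith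
qed

lemma B_nz: "\<bar>y\<bar> \<le> 1 / 8 \<Longrightarrow> B y \<noteq> 0"
  using norm_B_ge[of y] by auto

text \<open>
  By the stationary-point equation \<open>\<Phi>' = - 2 y N y / B y\<close> with \<open>N y = A + 2 w0\<^sup>2 + 3 w0 y + y\<^sup>2\<close>. The number \<open>m\<close> is the
  coefficient of \<open>y\<close> in the expansion of \<open>N y / B y\<close>, so that the cubic coefficient of \<open>\<Phi>\<close> is \<open>- 2/3 m\<close>.
\<close>

definition m :: complex where "m = (3 * w0 * A - 2 * w0 * (A + 2 * w0\<^sup>2)) / A\<^sup>2"

lemma norm_w0_sq_le: "norm (w0\<^sup>2) \<le> 1"
  using power_mono[OF norm_w0_le, of 2] by (simp add: norm_power)

lemma norm_m_le: "norm m \<le> 6" and norm_mA_le: "norm (m * A) \<le> 6"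
proof -
  have "norm (w0 * (A - 4 * w0\<^sup>2)) \<le> 1 * (2 + 4)"
    unfolding norm_mult using norm_w0_le norm_A_le norm_w0_sq_le norm_triangle_ineq4[of A "4 * w0\<^sup>2"]
    by (intro mult_mono) (auto simp: norm_mult)
  moreover have mA: "m * A\<^sup>2 = w0 * (A - 4 * w0\<^sup>2)"
  proof -
    have "m * A\<^sup>2 = 3 * w0 * A - 2 * w0 * (A + 2 * w0\<^sup>2)" using A_nz by (simp add: m_def)
    then show ?thesis by (simp add: algebra_simps)
  qed
  moreover have "norm m * norm A * norm A = norm (m * A\<^sup>2)"
    by (simp only: norm_mult norm_power power2_eq_square mult.assoc)
  ultimately have *: "norm m * norm A * norm A \<le> 6" by simp
  have "norm m * norm A * 1 \<le> norm m * norm A * norm A"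
    using norm_A_ge by (intro mult_left_mono) auto
  then have **: "norm m * norm A \<le> 6" using * by simp
  then show "norm (m * A) \<le> 6" by (simp add: norm_mult)
  have "norm m * 1 \<le> norm m * norm A" using norm_A_ge by (intro mult_left_mono) auto
  then show "norm m \<le> 6" using ** by simp
qed

text \<open>
  This expansion and the next one have explicit remainders, obtained by clearing denominators.
  Their constants are uniform since \<open>A\<close> and \<open>B y\<close> stay away from \<open>0\<close>; for simplicity \<open>80\<close> serves for
  both.
\<close>

lemma amplitude_expansion:
  assumes y: "\<bar>y\<bar> \<le> 1 / 8"
  shows "norm (1 / B y - 1 / A - (- 2 * w0 / A\<^sup>2) * of_real y) \<le> 80 * y\<^sup>2"
proof -
  define t where "t = complex_of_real y"
  define b where "b = B y"
  have b: "b = A + 2 * w0 * t + t\<^sup>2" by (simp add: b_def t_def B_eq)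
  have bnz: "b \<noteq> 0" using B_nz[OF y] by (simp add: b_def)
  have t: "norm t \<le> 1 / 8" using y by (simp add: t_def)
  have "(1 / b - 1 / A - (- 2 * w0 / A\<^sup>2) * t) * (A\<^sup>2 * b) = A\<^sup>2 - A * b + 2 * w0 * t * b"
    using A_nz bnz by (simp add: field_simps power2_eq_square)
  also have "\<dots> = t\<^sup>2 * (- A + 2 * w0 * (2 * w0 + t))"
    unfolding b by (simp add: algebra_simps power2_eq_square)
  finally have eq: "1 / b - 1 / A - (- 2 * w0 / A\<^sup>2) * t = t\<^sup>2 * (- A + 2 * w0 * (2 * w0 + t)) / (A\<^sup>2 * b)"
    using A_nz bnz by (simp add: nonzero_eq_divide_eq)
  have n1: "norm (2 * w0 + t) \<le> 3"
    using norm_triangle_ineq[of "2 * w0" t] norm_w0_le t by (simp add: norm_mult)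
  have "norm (w0 * (2 * w0 + t)) \<le> 1 * 3"
    unfolding norm_mult using n1 norm_w0_le by (intro mult_mono) auto
  then have n2: "norm (- A + 2 * w0 * (2 * w0 + t)) \<le> 8"
    using norm_triangle_ineq[of "- A" "2 * w0 * (2 * w0 + t)"] norm_A_le by (simp add: norm_mult)
  have "1\<^sup>2 * (1 / 2) \<le> norm (A\<^sup>2 * b)"
    unfolding norm_mult norm_power using norm_A_ge norm_B_ge[OF y]
    by (intro mult_mono power_mono) (auto simp: b_def)
  then have "norm (t\<^sup>2 * (- A + 2 * w0 * (2 * w0 + t)) / (A\<^sup>2 * b)) \<le> (y\<^sup>2 * 8) / (1 / 2)"
    unfolding norm_divide using n2
    by (intro frac_le) (auto simp: norm_mult norm_power t_def intro!: mult_left_mono)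
  also have "(y\<^sup>2 * 8) / (1 / 2) \<le> 80 * y\<^sup>2" by simp
  finally show ?thesis unfolding b_def[symmetric] t_def[symmetric] eq .
qed

lemma phase_derivative_expansion:
  assumes y: "\<bar>y\<bar> \<le> 1 / 8"
  shows "norm (- 2 * (w0 + of_real y) - 2 * \<i> / B y + \<kappa> * of_real y + 2 * m * (of_real y)\<^sup>2) \<le> 80 * \<bar>y\<bar> ^ 3"
proof -
  define t where "t = complex_of_real y"
  define b where "b = B y"
  have b: "b = A + 2 * w0 * t + t\<^sup>2" by (simp add: b_def t_def B_eq)
  have bnz: "b \<noteq> 0" using B_nz[OF y] by (simp add: b_def)
  have t: "norm t \<le> 1 / 8" using y by (simp add: t_def)
  define \<mu> where "\<mu> = m * A"
  have \<mu>: "\<mu> * A = 3 * w0 * A - 2 * w0 * (A + 2 * w0\<^sup>2)"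
    using A_nz by (simp add: \<mu>_def m_def power2_eq_square)
  have \<kappa>A: "\<kappa> * A = 2 * A + 4 * w0\<^sup>2" using A_nz by (simp add: \<kappa>_def algebra_simps)
  define X where "X = - 2 * (w0 + t) - 2 * \<i> / b + \<kappa> * t + 2 * m * t\<^sup>2"
  have "X * (A * b) = - 2 * (w0 + t) * A * b - 2 * \<i> * A + (\<kappa> * A) * t * b + 2 * \<mu> * t\<^sup>2 * b"
    using bnz by (simp add: X_def \<mu>_def algebra_simps)
  also have "2 * \<i> * A = - 2 * (w0 * A) * A" unfolding stationary by simp
  also have "- 2 * (w0 + t) * A * b - - 2 * (w0 * A) * A + (\<kappa> * A) * t * b + 2 * \<mu> * t\<^sup>2 * b
      = - 2 * t ^ 3 * (- 2 * w0\<^sup>2 - \<mu> * (2 * w0 + t))"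
    using \<mu> unfolding \<kappa>A b by algebra
  finally have X: "X = - 2 * t ^ 3 * (- 2 * w0\<^sup>2 - \<mu> * (2 * w0 + t)) / (A * b)"
    using A_nz bnz by (metis nonzero_eq_divide_eq mult_eq_0_iff)
  have n1: "norm (2 * w0 + t) \<le> 3"
    using norm_triangle_ineq[of "2 * w0" t] norm_w0_le t by (simp add: norm_mult)
  have "norm (\<mu> * (2 * w0 + t)) \<le> 6 * 3"
    unfolding norm_mult using n1 norm_mA_le by (intro mult_mono) (auto simp: \<mu>_def norm_mult)
  then have n2: "norm (- 2 * w0\<^sup>2 - \<mu> * (2 * w0 + t)) \<le> 20"
    using norm_triangle_ineq4[of "- 2 * w0\<^sup>2" "\<mu> * (2 * w0 + t)"] norm_w0_sq_le by (simp add: norm_mult)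
  have "1 * (1 / 2) \<le> norm (A * b)"
    unfolding norm_mult using norm_A_ge norm_B_ge[OF y] by (intro mult_mono) (auto simp: b_def)
  moreover have "norm (- 2 * t ^ 3 * (- 2 * w0\<^sup>2 - \<mu> * (2 * w0 + t))) \<le> 2 * \<bar>y\<bar> ^ 3 * 20"
    unfolding norm_mult norm_power using n2 by (intro mult_mono) (auto simp: t_def)
  ultimately have "norm X \<le> (2 * \<bar>y\<bar> ^ 3 * 20) / (1 / 2)"
    unfolding X norm_divide by (intro frac_le) auto
  also have "(2 * \<bar>y\<bar> ^ 3 * 20) / (1 / 2) \<le> 80 * \<bar>y\<bar> ^ 3" by simp
  finally show ?thesis by (simp only: X_def b_def t_def)
qed

text \<open>
  Integrate the expansion of the derivative along the segment from \<open>0\<close> to \<open>y\<close>. The segment has to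
  stay in the right half-plane, where \<open>phase\<close> is holomorphic; hence \<open>\<bar>y\<bar> < u\<close>.
\<close>

lemma phase_expansion:
  assumes y: "\<bar>y\<bar> \<le> 1 / 8" "\<bar>y\<bar> < u"
  shows "norm (phase \<delta> (w0 + of_real y) - phase \<delta> w0 + \<kappa> / 2 * of_real y ^ 2 - (- 2 / 3 * m) * of_real y ^ 3)
          \<le> 80 * y ^ 4"
proof -
  define P where "P = (\<lambda>t. phase \<delta> (w0 + t) - phase \<delta> w0 + \<kappa> / 2 * t ^ 2 - (- 2 / 3 * m) * t ^ 3)"
  define P' where "P' = (\<lambda>t. - 2 * (w0 + t) - 2 * \<i> / ((w0 + t)\<^sup>2 + of_real (\<delta>\<^sup>2)) + \<kappa> * t + 2 * m * t\<^sup>2)"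
  let ?S = "closed_segment 0 (complex_of_real y)"
  have seg: "\<exists>s. t = of_real s \<and> \<bar>s\<bar> \<le> \<bar>y\<bar>" if t: "t \<in> ?S" for t
  proof -
    obtain r where r: "0 \<le> r" "r \<le> 1" "t = of_real r * of_real y"
      using t by (auto simp: closed_segment_def scaleR_conv_of_real)
    then show ?thesis
      using mult_left_le_one_le[of "\<bar>y\<bar>" r] by (intro exI[of _ "r * y"]) (auto simp: abs_mult)
  qed
  have "norm (P (of_real y) - P 0) \<le> (80 * \<bar>y\<bar> ^ 3) * norm (complex_of_real y - 0)"
  proof (rule field_differentiable_bound[where S = ?S])
    fix t assume "t \<in> ?S"
    then obtain s where s: "t = of_real s" "\<bar>s\<bar> \<le> \<bar>y\<bar>" using seg by blast
    then have "Re (w0 + t) > 0" using y by (simp add: w0_def)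
    then have "(phase \<delta> has_field_derivative
        (- 2 * (w0 + t) - 2 * \<i> / ((w0 + t)\<^sup>2 + of_real (\<delta>\<^sup>2)))) (at (w0 + t))"
      by (rule has_field_derivative_phase[OF \<delta>_nonneg])
    moreover have "((\<lambda>t. w0 + t) has_field_derivative 1) (at t)"
      by (auto intro!: derivative_eq_intros)
    ultimately have "((\<lambda>t. phase \<delta> (w0 + t)) has_field_derivative
        (- 2 * (w0 + t) - 2 * \<i> / ((w0 + t)\<^sup>2 + of_real (\<delta>\<^sup>2))) * 1) (at t)"
      by (rule DERIV_chain2)
    from has_field_derivative_at_within[OF this, of ?S]
    show "(P has_field_derivative P' t) (at t within ?S)"
      unfolding P_def P'_def by (auto intro!: derivative_eq_intros simp: algebra_simps power2_eq_square)
    have "norm (P' t) \<le> 80 * \<bar>s\<bar> ^ 3"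
      using phase_derivative_expansion[of s] s y unfolding P'_def s(1) B_def by simp
    also have "\<dots> \<le> 80 * \<bar>y\<bar> ^ 3" using s by (intro mult_left_mono power_mono) auto
    finally show "norm (P' t) \<le> 80 * \<bar>y\<bar> ^ 3" .
  qed auto
  also have "\<dots> = 80 * \<bar>y\<bar> ^ 4" by (simp add: power_Suc eval_nat_numeral)
  finally show ?thesis by (simp add: P_def)
qed

end

text \<open>
  This is \<open>exp (L \<Phi>) / (w\<^sup>2 + \<delta>\<^sup>2)\<close> with the denominator cancelled against a factor of the \<open>n\<close>-th power,
  and without logarithm. For \<open>n \<ge> 1\<close> this form shows that \<open>- \<i> \<delta>\<close> is no singularity and that the function is
  holomorphic on the half-plane \<open>Im w < \<delta>\<close>.
\<close>

definition kernel :: "real \<Rightarrow> nat \<Rightarrow> real \<Rightarrow> complex \<Rightarrow> complex" where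
  "kernel \<delta> n L w = exp (- of_real L * w\<^sup>2) * (w + \<i> * of_real \<delta>) ^ (n - 1) / (w - \<i> * of_real \<delta>) ^ (n + 1)"

lemma kernel_eq:
  assumes "n \<ge> 1" "w \<noteq> \<i> * of_real \<delta>" "w \<noteq> - \<i> * of_real \<delta>"
  shows "kernel \<delta> n L w
    = exp (- of_real L * w\<^sup>2) * ((w + \<i> * of_real \<delta>) / (w - \<i> * of_real \<delta>)) ^ n / (w\<^sup>2 + of_real (\<delta>\<^sup>2))"
proof -
  define p where "p = w + \<i> * of_real \<delta>"
  define q where "q = w - \<i> * of_real \<delta>"
  have pq: "p \<noteq> 0" "q \<noteq> 0" using assms by (auto simp: p_def q_def add_eq_0_iff2)
  have w: "w\<^sup>2 + of_real (\<delta>\<^sup>2) = p * q" by (simp add: p_def q_def algebra_simps power2_eq_square)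
  obtain k where k: "n = Suc k" using assms by (cases n) auto
  show ?thesis
    unfolding kernel_def w p_def[symmetric] q_def[symmetric] k
    using pq by (simp add: power_divide)
qed

lemma kernel_eq_phase:
  assumes "n \<ge> 1" "\<delta> > 0" "L = real n * \<delta>" "Re w \<noteq> 0"
  shows "kernel \<delta> n L w = exp (of_real L * phase \<delta> w) / (w\<^sup>2 + of_real (\<delta>\<^sup>2))"
proof -
  have w: "w \<noteq> \<i> * of_real \<delta>" "w \<noteq> - \<i> * of_real \<delta>" using assms by auto
  show ?thesis
    unfolding kernel_eq[OF assms(1) w] using assms w by (subst exp_phase[of \<delta> L n]) auto
qed

context lower_saddle
begin

text \<open>
  On the horizontal line through the saddle the integrand decays like a Gaussian about the
  saddle, uniformly. In terms of \<open>s = x\<^sup>2\<close> the real part of the phase is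
  \<open>v\<^sup>2 - s + 1/(2\<delta>) ln ((s + a) / (s + b))\<close> with \<open>a = (v - \<delta>)\<^sup>2\<close> and \<open>b = (v + \<delta>)\<^sup>2\<close>, and \<open>ln z \<le> z - 1\<close>, applied to the quotient of the values
  of \<open>(s + a) / (s + b)\<close> at \<open>s\<close> and at \<open>u\<^sup>2\<close>, shows that it is at most its value at the saddle minus \<open>(s - u\<^sup>2)\<^sup>2 / (s + b)\<close>.

  The line may come close to the zero \<open>- \<i> \<delta>\<close> of the denominator \<open>w\<^sup>2 + \<delta>\<^sup>2\<close>, so the amplitude has no uniform
  bound. This is compensated by giving up one of the \<open>n\<close> factors \<open>(w + \<i> \<delta>) / (w - \<i> \<delta>)\<close>, and \<open>n \<ge> 2\<close> ensures that the
  other ones retain half of the decay.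
\<close>

lemma kernel_bound:
  assumes n: "n \<ge> 2" and d: "\<delta> > 0" and L: "L = real n * \<delta>" and x: "x \<ge> 0"
  shows "norm (kernel \<delta> n L (Complex x (- v)))
    \<le> 40 * exp 2 * norm (exp (of_real L * phase \<delta> w0)) * exp (- (L * u\<^sup>2 / 18) * (x - u)\<^sup>2)"
proof -
  define s where "s = x\<^sup>2"
  define a where "a = (v - \<delta>)\<^sup>2"
  define b where "b = (v + \<delta>)\<^sup>2"
  define q where "q = (s - u\<^sup>2) * (u\<^sup>2 + b) / (s + b)"
  have s0: "s \<ge> 0" and a0: "a \<ge> 0" by (auto simp: s_def a_def)
  have b1: "1 / 4 \<le> b" using power_mono[of "1/2" "v + \<delta>" 2] v_ge \<delta>_nonneg by (simp add: b_def power2_eq_square)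
  have b9: "b \<le> 9" using power_mono[of "v + \<delta>" 3 2] v_less_1 \<delta>_less_2 v_pos \<delta>_nonneg by (simp add: b_def)
  have u2: "0 < u\<^sup>2" "u\<^sup>2 \<le> 1" using u_pos u_le_1 by (auto simp: abs_square_le_1)
  have np: "(norm (Complex z (- v) + \<i> * of_real \<delta>))\<^sup>2 = z\<^sup>2 + a" for z
    unfolding cmod_power2 a_def by (simp add: power2_eq_square algebra_simps)
  have nq: "(norm (Complex z (- v) - \<i> * of_real \<delta>))\<^sup>2 = z\<^sup>2 + b" for z
    unfolding cmod_power2 b_def by (simp add: power2_eq_square algebra_simps)
  have ne: "norm (exp (- of_real L * (Complex z (- v))\<^sup>2)) = exp (- L * (z\<^sup>2 - v\<^sup>2))" for z
    by (simp add: power2_eq_square)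
  have w0': "w0 = Complex u (- v)" by (simp add: w0_def)
  have uab: "(u\<^sup>2 + a) * (u\<^sup>2 + b) = 2 * v"
  proof -
    have "(norm A)\<^sup>2 = (norm ((w0 + \<i> * of_real \<delta>) * (w0 - \<i> * of_real \<delta>)))\<^sup>2"
      by (simp add: A_def power2_eq_square algebra_simps)
    also have "\<dots> = (u\<^sup>2 + a) * (u\<^sup>2 + b)" unfolding norm_mult power_mult_distrib w0' np nq ..
    finally show ?thesis by (simp add: norm_A_sq)
  qed
  have ua: "0 < u\<^sup>2 + a" "0 < u\<^sup>2 + b" "0 < s + b" using u2 a0 b1 s0 by linarith+
  define r where "r = norm (Complex x (- v) + \<i> * of_real \<delta>) / norm (Complex x (- v) - \<i> * of_real \<delta>)"
  define r0 where "r0 = norm (w0 + \<i> * of_real \<delta>) / norm (w0 - \<i> * of_real \<delta>)"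
  have r2: "r\<^sup>2 = (s + a) / (s + b)" unfolding r_def power_divide np nq by (simp add: s_def)
  have r02: "r0\<^sup>2 = (u\<^sup>2 + a) / (u\<^sup>2 + b)" unfolding r0_def power_divide w0' np nq ..
  have r0_pos: "r0 > 0"
  proof -
    have "r0\<^sup>2 > 0" unfolding r02 using ua by simp
    moreover have "r0 \<ge> 0" by (simp add: r0_def)
    ultimately show ?thesis by (cases "r0 = 0") auto
  qed
  \<comment> \<open>Here the stationary-point equation enters, as \<open>(u\<^sup>2 + a) (u\<^sup>2 + b) = 2 v\<close>.\<close>
  have ratio: "r\<^sup>2 = r0\<^sup>2 * (1 + 2 * (\<delta> * q))"
  proof -
    have "r0\<^sup>2 * (1 + 2 * (\<delta> * q)) = (u\<^sup>2 + a) / (u\<^sup>2 + b) + 2 * \<delta> * (s - u\<^sup>2) * (u\<^sup>2 + a) / (s + b)"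
      unfolding r02 q_def using ua by (simp add: field_simps)
    also have "\<dots> = ((u\<^sup>2 + a) * (s + b) + \<delta> * (s - u\<^sup>2) * (2 * ((u\<^sup>2 + a) * (u\<^sup>2 + b)))) / ((u\<^sup>2 + b) * (s + b))"
      using ua by (simp add: divide_simps)
    also have "(u\<^sup>2 + a) * (s + b) + \<delta> * (s - u\<^sup>2) * (2 * ((u\<^sup>2 + a) * (u\<^sup>2 + b))) = (s + a) * (u\<^sup>2 + b)"
      unfolding uab unfolding a_def b_def by (simp add: power2_eq_square algebra_simps)
    finally show ?thesis using ua by (simp add: r2)
  qed
  \<comment> \<open>The inequality \<open>1 + t \<le> exp t\<close> is the estimate \<open>ln z \<le> z - 1\<close> mentioned above.\<close>
  have r_le: "r \<le> r0 * exp (\<delta> * q)"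
  proof (rule power2_le_imp_le)
    have "r0\<^sup>2 * (1 + 2 * (\<delta> * q)) \<le> r0\<^sup>2 * exp (2 * (\<delta> * q))"
      by (intro mult_left_mono exp_ge_add_one_self) auto
    then show "r\<^sup>2 \<le> (r0 * exp (\<delta> * q))\<^sup>2"
      by (simp add: ratio power_mult_distrib exp_double)
  qed (use r0_pos in simp)
  have r0_ge: "1 / 10 \<le> r0"
  proof (rule power2_le_imp_le)
    have "(u\<^sup>2 + b) * (u\<^sup>2 + b) \<le> 10 * 10" using ua b9 u2 by (intro mult_mono) auto
    moreover have "r0\<^sup>2 * ((u\<^sup>2 + b) * (u\<^sup>2 + b)) = 2 * v"
      unfolding uab[symmetric] r02 using ua by simp
    moreover have "r0\<^sup>2 * ((u\<^sup>2 + b) * (u\<^sup>2 + b)) \<le> r0\<^sup>2 * (10 * 10)"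
      using calculation by (intro mult_left_mono) auto
    ultimately show "(1 / 10)\<^sup>2 \<le> r0\<^sup>2" using v_ge by (simp add: power2_eq_square)
  qed (use r0_pos in simp)
  \<comment> \<open>\<open>(s - u\<^sup>2)\<^sup>2 / (s + b) = (x - u)\<^sup>2 (x + u)\<^sup>2 / (s + b)\<close>, and \<open>(x + u)\<^sup>2 / (s + b) \<ge> u\<^sup>2 / 9\<close> as \<open>b \<le> 9\<close> and \<open>u \<le> 1\<close>.\<close>
  have qle: "q - (s - u\<^sup>2) \<le> - (u\<^sup>2 / 9) * (x - u)\<^sup>2"
  proof -
    have "u\<^sup>2 * b \<le> u\<^sup>2 * 9" using b9 by (intro mult_left_mono) auto
    moreover have "u\<^sup>2 * s \<le> 1 * s" using u2(2) s0 by (rule mult_right_mono)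
    ultimately have "u\<^sup>2 / 9 * (s + b) \<le> s + u\<^sup>2" using s0 by (simp add: field_simps)
    also have "\<dots> \<le> (x + u)\<^sup>2" using x u_pos by (simp add: s_def power2_sum)
    finally have "(x - u)\<^sup>2 * (u\<^sup>2 / 9 * (s + b)) \<le> (x - u)\<^sup>2 * (x + u)\<^sup>2" by (intro mult_left_mono) auto
    also have "\<dots> = (s - u\<^sup>2)\<^sup>2" by (simp add: s_def power2_eq_square algebra_simps)
    finally have "u\<^sup>2 / 9 * (x - u)\<^sup>2 \<le> (s - u\<^sup>2)\<^sup>2 / (s + b)" using ua by (simp add: field_simps)
    moreover have "q - (s - u\<^sup>2) = - ((s - u\<^sup>2)\<^sup>2 / (s + b))"
      unfolding q_def using ua by (simp add: field_simps power2_eq_square)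
    ultimately show ?thesis by simp
  qed
  obtain k where k: "n = Suc k" "k \<ge> 1" using n by (cases n) auto
  \<comment> \<open>The term \<open>- \<delta> (s - u\<^sup>2)\<close> belongs to the factor that was given up; it is bounded by \<open>2\<close>.\<close>
  have expo: "- L * (s - u\<^sup>2) + real k * (\<delta> * q) \<le> 2 + - (L * u\<^sup>2 / 18) * (x - u)\<^sup>2"
  proof -
    have "- L * (s - u\<^sup>2) + real k * (\<delta> * q) = - \<delta> * (s - u\<^sup>2) + real k * \<delta> * (q - (s - u\<^sup>2))"
      by (simp add: L k algebra_simps)
    also have "\<dots> \<le> 2 + real k * \<delta> * (- (u\<^sup>2 / 9) * (x - u)\<^sup>2)"
    proof (intro add_mono mult_left_mono qle)
      have "\<delta> * u\<^sup>2 \<le> 2 * 1" using \<delta>_less_2 u2 d by (intro mult_mono) auto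
      moreover have "\<delta> * s \<ge> 0" using d s0 by simp
      ultimately show "- \<delta> * (s - u\<^sup>2) \<le> 2" by (simp add: algebra_simps)
    qed (use d in auto)
    also have "real k * \<delta> * (- (u\<^sup>2 / 9) * (x - u)\<^sup>2) \<le> - (L * u\<^sup>2 / 18) * (x - u)\<^sup>2"
    proof -
      have "L / 2 \<le> real k * \<delta>" using k d by (simp add: L algebra_simps)
      then have "L / 2 * (u\<^sup>2 / 9 * (x - u)\<^sup>2) \<le> real k * \<delta> * (u\<^sup>2 / 9 * (x - u)\<^sup>2)"
        by (intro mult_right_mono) auto
      then show ?thesis by simp
    qed
    finally show ?thesis by simp
  qed
  have E0: "norm (exp (of_real L * phase \<delta> w0)) = exp (- L * (u\<^sup>2 - v\<^sup>2)) * r0 ^ n"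
  proof -
    have "w0 \<noteq> \<i> * of_real \<delta>" "w0 \<noteq> - \<i> * of_real \<delta>" using u_pos by (auto simp: w0_def complex_eq_iff)
    then have "exp (of_real L * phase \<delta> w0) = exp (- of_real L * w0\<^sup>2) * ((w0 + \<i> * of_real \<delta>) / (w0 - \<i> * of_real \<delta>)) ^ n"
      using d L by (intro exp_phase) auto
    then show ?thesis by (simp only: norm_mult norm_power norm_divide r0_def w0' ne)
  qed
  have "norm (kernel \<delta> n L (Complex x (- v))) = exp (- L * (s - v\<^sup>2)) * r ^ k / (s + b)"
  proof -
    have "norm (kernel \<delta> n L (Complex x (- v))) = exp (- L * (s - v\<^sup>2)) *
        (norm (Complex x (- v) + \<i> * of_real \<delta>) ^ k / (norm (Complex x (- v) - \<i> * of_real \<delta>) ^ k * (norm (Complex x (- v) - \<i> * of_real \<delta>))\<^sup>2))"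
      unfolding kernel_def norm_mult norm_divide norm_power ne k s_def by (simp add: power2_eq_square)
    then show ?thesis unfolding nq r_def power_divide s_def by simp
  qed
  also have "\<dots> \<le> exp (- L * (s - v\<^sup>2)) * (r0 * exp (\<delta> * q)) ^ k / (1 / 4)"
    using b1 s0 r_le r0_pos
    by (intro frac_le mult_left_mono power_mono mult_nonneg_nonneg zero_le_power) (auto simp: r_def)
  also have "\<dots> = 4 * exp (- L * (s - v\<^sup>2) + real k * (\<delta> * q)) * r0 ^ k"
    by (simp only: power_mult_distrib exp_add exp_of_nat_mult) simp
  also have "- L * (s - v\<^sup>2) + real k * (\<delta> * q) = - L * (u\<^sup>2 - v\<^sup>2) + (- L * (s - u\<^sup>2) + real k * (\<delta> * q))"
    by (simp add: algebra_simps)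
  also have "4 * exp (- L * (u\<^sup>2 - v\<^sup>2) + (- L * (s - u\<^sup>2) + real k * (\<delta> * q))) * r0 ^ k
      \<le> 4 * exp (- L * (u\<^sup>2 - v\<^sup>2) + (2 + - (L * u\<^sup>2 / 18) * (x - u)\<^sup>2)) * (10 * r0 ^ n)"
  proof (intro mult_mono)
    show "r0 ^ k \<le> 10 * r0 ^ n" using r0_ge r0_pos mult_right_mono[OF r0_ge, of "r0 ^ k"] by (simp add: k)
  qed (use expo r0_pos in auto)
  also have "\<dots> = 40 * exp 2 * (exp (- L * (u\<^sup>2 - v\<^sup>2)) * r0 ^ n) * exp (- (L * u\<^sup>2 / 18) * (x - u)\<^sup>2)"
    by (simp only: exp_add) simp
  finally show ?thesis by (simp only: E0)
qed

end

section \<open>Chebyshev coefficients as contour integrals\<close>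

lemma Re_of_real_mult: "Re (of_real r * z) = r * Re z"
  by simp

text \<open>
  For \<open>z = exp (\<i> \<theta>)\<close> this is \<open>T n (cos \<theta>) = cos (n \<theta>)\<close>. The substitution used below parametrises the unit
  circle rationally, and this form needs no angles.
\<close>

lemma chebyshev_T_Re:
  assumes "norm z = 1"
  shows "chebyshev_T n (Re z) = Re (z ^ n)"
proof (induction n "Re z" rule: chebyshev_T.induct)
  case (3 n)
  have "(Re z)\<^sup>2 + (Im z)\<^sup>2 = 1" using assms by (simp add: cmod_def)
  then have "z * z = of_real (2 * Re z) * z - 1"
    by (auto simp: complex_eq_iff power2_eq_square algebra_simps)
  then have "z * z * z ^ n = (of_real (2 * Re z) * z - 1) * z ^ n" by simp
  then have "z ^ Suc (Suc n) = of_real (2 * Re z) * z ^ Suc n - z ^ n"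
    by (simp add: left_diff_distrib mult.assoc)
  then have "Re (z ^ Suc (Suc n)) = 2 * Re z * Re (z ^ Suc n) - Re (z ^ n)"
    by (simp only: minus_complex.sel Re_of_real_mult)
  then show ?case using 3 by simp
qed auto

lemma borel_measurable_chebyshev_T [measurable]: "chebyshev_T n \<in> borel_measurable borel"
proof -
  have "continuous_on UNIV (\<lambda>x. chebyshev_T n x)"
  proof (induction n rule: induct_nat_012)
    case (ge2 n)
    then show ?case by (auto intro!: continuous_intros)
  qed auto
  then show ?thesis by (rule borel_measurable_continuous_onI)
qed

lemma kernel_holomorphic: "kernel \<delta> n L holomorphic_on {w. Im w < \<delta>}"
  unfolding kernel_def by (intro holomorphic_intros) auto

lemma kernel_reflect: "kernel \<delta> n L (Complex (- x) y) = cnj (kernel \<delta> n L (Complex x y))" if n: "n \<ge> 1"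
proof -
  define w where "w = Complex x y"
  obtain k where k: "n = Suc k" using n by (cases n) auto
  have r: "Complex (- x) y = - cnj w" by (simp add: w_def complex_eq_iff)
  have p: "- cnj w + \<i> * of_real \<delta> = - cnj (w + \<i> * of_real \<delta>)"
    and q: "- cnj w - \<i> * of_real \<delta> = - cnj (w - \<i> * of_real \<delta>)" by (auto simp: complex_eq_iff)
  have "(- 1 :: complex) ^ (n - 1) = (- 1) ^ (n + 1)" by (simp add: k)
  then show ?thesis
    unfolding r kernel_def p q power_minus[of "cnj _"] w_def[symmetric]
    by (simp add: exp_cnj)
qed

text \<open>
  On and below the real axis \<open>w\<close> is at least as close to \<open>- \<i> \<delta>\<close> as to \<open>\<i> \<delta>\<close>, so the quotient of the linear factors is at most
  \<open>1\<close> and the Gaussian factor alone gives decay.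
\<close>

lemma norm_kernel_strip:
  assumes n: "n \<ge> 1" and d: "\<delta> > 0" and L: "L > 0" and w: "- v \<le> Im w" "Im w \<le> 0"
  shows "norm (kernel \<delta> n L w) \<le> exp (L * v\<^sup>2) / \<delta>\<^sup>2 * exp (- L * (Re w)\<^sup>2)"
proof -
  obtain k where k: "n = Suc k" using n by (cases n) auto
  define p where "p = norm (w + \<i> * of_real \<delta>)"
  define q where "q = norm (w - \<i> * of_real \<delta>)"
  have pq: "p \<le> q"
  proof (rule power2_le_imp_le)
    have "\<delta> * Im w \<le> 0" using d w by (simp add: mult_nonneg_nonpos)
    then show "p\<^sup>2 \<le> q\<^sup>2" unfolding p_def q_def cmod_power2 by (simp add: power2_eq_square algebra_simps)
  qed (simp add: q_def)
  have qd: "\<delta> \<le> q" using abs_Im_le_cmod[of "w - \<i> * of_real \<delta>"] w d by (simp add: q_def)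
  then have q0: "q > 0" using d by simp
  have "(Im w)\<^sup>2 \<le> v\<^sup>2" using w by (simp add: abs_le_square_iff[symmetric])
  then have "L * (Im w)\<^sup>2 \<le> L * v\<^sup>2" using L by simp
  then have e: "norm (exp (- of_real L * w\<^sup>2)) \<le> exp (L * v\<^sup>2) * exp (- L * (Re w)\<^sup>2)"
    by (simp add: algebra_simps Re_power2 flip: exp_add)
  have pp: "p ^ k \<le> q ^ k" using pq by (intro power_mono) (auto simp: p_def)
  have "norm (kernel \<delta> n L w) = norm (exp (- of_real L * w\<^sup>2)) * (p ^ k / (q ^ k * q\<^sup>2))"
    unfolding kernel_def norm_mult norm_divide norm_power k p_def q_def by (simp add: power2_eq_square)
  also have "\<dots> \<le> (exp (L * v\<^sup>2) * exp (- L * (Re w)\<^sup>2)) * (1 / \<delta>\<^sup>2)"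
  proof (intro mult_mono e)
    have "p ^ k / (q ^ k * q\<^sup>2) \<le> q ^ k / (q ^ k * q\<^sup>2)"
      using pp q0 by (intro divide_right_mono) auto
    also have "\<dots> = 1 / q\<^sup>2" using q0 by simp
    also have "\<dots> \<le> 1 / \<delta>\<^sup>2" using qd d by (intro divide_left_mono power_mono) auto
    finally show "p ^ k / (q ^ k * q\<^sup>2) \<le> 1 / \<delta>\<^sup>2" .
  qed (use q0 in \<open>auto simp: p_def\<close>)
  finally show ?thesis by (simp add: mult_ac)
qed

lemma isCont_kernel_line:
  assumes "\<delta> > 0" "y \<ge> 0"
  shows "isCont (\<lambda>x. kernel \<delta> n L (Complex x (- y))) x"
proof -
  have "isCont (kernel \<delta> n L) (Complex x (- y))"
    using kernel_holomorphic assms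
    by (intro continuous_on_interior[OF holomorphic_on_imp_continuous_on[OF kernel_holomorphic]])
       (auto simp: interior_open open_halfspace_Im_lt)
  moreover have "isCont (\<lambda>x. Complex x (- y)) x"
    unfolding Complex_eq by (intro continuous_intros)
  ultimately show ?thesis by (rule isCont_o2[rotated])
qed

lemma borel_measurable_kernel_line:
  "\<delta> > 0 \<Longrightarrow> y \<ge> 0 \<Longrightarrow> (\<lambda>x. kernel \<delta> n L (Complex x (- y))) \<in> borel_measurable borel"
  by (intro borel_measurable_continuous_onI continuous_at_imp_continuous_on ballI isCont_kernel_line)

lemma integrable_kernel_line:
  assumes "n \<ge> 1" "\<delta> > 0" "L > 0" "y \<ge> 0"
  shows "integrable lborel (\<lambda>x. kernel \<delta> n L (Complex x (- y)))"
proof (rule integral_dominated_by_gaussian(1)[where c = L and u = 0])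
  show "norm (kernel \<delta> n L (Complex x (- y))) \<le> exp (L * y\<^sup>2) / \<delta>\<^sup>2 * exp (- L * (x - 0)\<^sup>2)" for x
    using norm_kernel_strip[of n \<delta> L y "Complex x (- y)"] assms by simp
qed (use assms in \<open>auto intro: borel_measurable_kernel_line\<close>)

text \<open>
  The real axis may be pushed down to the height of the saddle: the kernel has no singularity below
  the real axis, and by the bound on the strip a primitive has nearly the same values at the
  ends of the two lines.
\<close>

lemma kernel_contour_shift:
  assumes n: "n \<ge> 1" and d: "\<delta> > 0" and L: "L > 0" and v: "v \<ge> 0"
  shows "(LBINT x. kernel \<delta> n L (Complex x 0)) = (LBINT x. kernel \<delta> n L (Complex x (- v)))"
proof -
  let ?H = "{w. Im w < \<delta>}"
  have "open ?H" "convex ?H" by (simp_all add: open_halfspace_Im_lt convex_halfspace_Im_lt)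
  then obtain G where G: "\<And>w. w \<in> ?H \<Longrightarrow> (G has_field_derivative kernel \<delta> n L w) (at w)"
    using holomorphic_convex_primitive'[OF _ _ kernel_holomorphic] by (metis at_within_open)
  have Gline: "((\<lambda>x. G (Complex x (- y))) has_vector_derivative kernel \<delta> n L (Complex x (- y))) (at x)"
    if "y \<ge> 0" for x y
  proof -
    have "((\<lambda>x. Complex x (- y)) has_vector_derivative 1) (at x)"
      unfolding Complex_eq by (auto intro!: derivative_eq_intros)
    from field_vector_diff_chain_at[OF this G] show ?thesis using that d by (simp add: o_def)
  qed
  define h where "h = (\<lambda>x. kernel \<delta> n L (Complex x (- 0)) - kernel \<delta> n L (Complex x (- v)))"
  have int: "integrable lborel (\<lambda>x. kernel \<delta> n L (Complex x (- y)))" if "y \<ge> 0" for y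
    using that n d L by (intro integrable_kernel_line) auto
  have "(LBINT x. h x) = 0"
  proof (rule integral_vanishes_if_primitive_vanishes)
    show "((\<lambda>x. G (Complex x (- 0)) - G (Complex x (- v))) has_vector_derivative h x) (at x)" for x
      unfolding h_def using v by (intro has_vector_derivative_diff Gline) auto
    show "isCont h x" for x
      unfolding h_def using d v by (intro continuous_intros isCont_kernel_line) auto
    show "integrable lborel h" unfolding h_def using v by (intro Bochner_Integration.integrable_diff int) auto
    show "((\<lambda>x. G (Complex x (- 0)) - G (Complex x (- v))) \<longlongrightarrow> 0) at_infinity"
    proof (rule Lim_null_comparison)
      define C where "C = exp (L * v\<^sup>2) / \<delta>\<^sup>2 * v"
      have C: "C \<ge> 0" using v by (simp add: C_def)
      show "\<forall>\<^sub>F x in at_infinity. norm (G (Complex x (- 0)) - G (Complex x (- v))) \<le> C * (\<bar>x\<bar> * exp (- L * x\<^sup>2))"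
        unfolding eventually_at_infinity
      proof (intro exI[of _ 1] allI impI)
        fix x :: real assume x: "1 \<le> norm x"
        let ?S = "closed_segment (Complex x (- v)) (Complex x (- 0))"
        have S: "Re w = x \<and> - v \<le> Im w \<and> Im w \<le> 0" if w: "w \<in> ?S" for w
        proof -
          obtain t where t: "0 \<le> t" "t \<le> 1" "w = (1 - t) *\<^sub>R Complex x (- v) + t *\<^sub>R Complex x (- 0)"
            using w by (auto simp: closed_segment_def)
          have "0 \<le> t * v" "t * v \<le> v" using t v by (auto simp: mult_left_le_one_le)
          moreover have "Re w = x" "Im w = - (v - t * v)" by (auto simp: t(3) algebra_simps)
          ultimately show ?thesis by simp
        qed
        have "norm (G (Complex x (- 0)) - G (Complex x (- v)))
            \<le> (exp (L * v\<^sup>2) / \<delta>\<^sup>2 * exp (- L * x\<^sup>2)) * norm (Complex x (- 0) - Complex x (- v))"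
        proof (rule field_differentiable_bound[where S = ?S])
          fix w assume w: "w \<in> ?S"
          show "norm (kernel \<delta> n L w) \<le> exp (L * v\<^sup>2) / \<delta>\<^sup>2 * exp (- L * x\<^sup>2)"
            using norm_kernel_strip[OF n d L, of v w] S[OF w] by simp
          show "(G has_field_derivative kernel \<delta> n L w) (at w within ?S)"
            using S[OF w] d by (intro has_field_derivative_at_within[OF G]) auto
        qed auto
        also have "Complex x (- 0) - Complex x (- v) = \<i> * of_real v" by (simp add: complex_eq_iff)
        also have "norm (\<i> * of_real v) = v" using v by (simp add: norm_mult)
        also have "exp (L * v\<^sup>2) / \<delta>\<^sup>2 * exp (- L * x\<^sup>2) * v = C * (1 * exp (- L * x\<^sup>2))" by (simp add: C_def)
        also have "\<dots> \<le> C * (\<bar>x\<bar> * exp (- L * x\<^sup>2))"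
          using x C by (intro mult_left_mono mult_right_mono) auto
        finally show "norm (G (Complex x (- 0)) - G (Complex x (- v))) \<le> C * (\<bar>x\<bar> * exp (- L * x\<^sup>2))" .
      qed
      show "((\<lambda>x. C * (\<bar>x\<bar> * exp (- L * x\<^sup>2))) \<longlongrightarrow> 0) at_infinity"
        by (intro tendsto_mult_right_zero abs_times_gaussian_tendsto_0 L)
    qed
  qed
  then show ?thesis
    unfolding h_def using int[of 0] int[of v] v by simp
qed

lemma integral_even_half_line:
  fixes f :: "real \<Rightarrow> real"
  assumes int: "integrable lborel f" and even: "\<And>x. f (- x) = f x"
  shows "(LBINT x:{0..}. f x) = (LBINT x. f x) / 2"
proof -
  have "integrable lborel (\<lambda>x. indicator {0..} x *\<^sub>R f x)"
    using int by (intro integrable_mult_indicator) auto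
  then have "has_bochner_integral lborel (\<lambda>x. indicator {0..} x *\<^sub>R f x) (LBINT x:{0..}. f x)"
    by (simp add: has_bochner_integral_iff set_lebesgue_integral_def)
  from has_bochner_integral_even_function[OF this even] show ?thesis
    by (simp add: has_bochner_integral_iff)
qed

text \<open>
  Substitute \<open>x = (\<delta>\<^sup>2 - w\<^sup>2) / (\<delta>\<^sup>2 + w\<^sup>2)\<close> with \<open>w > 0\<close>, that is, \<open>x = cos \<theta>\<close> with \<open>w = \<delta> tan (\<theta> / 2)\<close>. Then
  \<open>(1 - x) / (1 + x) = (w / \<delta>)\<^sup>2\<close> makes \<open>F\<close> a Gaussian, and \<open>- (w + \<i> \<delta>) / (w - \<i> \<delta>)\<close> is the point \<open>z\<close> of the unit circle
  with \<open>Re z = x\<close>.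
\<close>

lemma cheb_coeff_eq_half_line_integral:
  assumes n: "n \<ge> 1" and d: "\<delta> > 0" and L: "L = real n * \<delta>" and lam: "lam = L * \<delta>\<^sup>2"
  shows "cheb_coeff n lam = (- 1) ^ n * (4 * \<delta> / pi) * (LBINT w:{0..}. Re (kernel \<delta> n L (Complex w 0)))"
proof -
  define h where "h = (\<lambda>x. F lam x * chebyshev_T n x / sqrt (1 - x\<^sup>2))"
  define g where "g = (\<lambda>w. (\<delta>\<^sup>2 - w\<^sup>2) / (\<delta>\<^sup>2 + w\<^sup>2))"
  define g' where "g' = (\<lambda>w. - 4 * \<delta>\<^sup>2 * w / (\<delta>\<^sup>2 + w\<^sup>2)\<^sup>2)"
  define k where "k = (\<lambda>w. (- 1) ^ n * (2 * \<delta>) * Re (kernel \<delta> n L (Complex w 0)))"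
  have L0: "L > 0" using n d L by simp
  have pos: "\<delta>\<^sup>2 + w\<^sup>2 > 0" for w using d by (intro add_pos_nonneg) auto
  have der: "(g has_field_derivative g' w) (at w within S)" for w S
  proof -
    have "(g has_field_derivative ((- (2 * w)) * (\<delta>\<^sup>2 + w\<^sup>2) - (\<delta>\<^sup>2 - w\<^sup>2) * (2 * w)) / ((\<delta>\<^sup>2 + w\<^sup>2) * (\<delta>\<^sup>2 + w\<^sup>2))) (at w within S)"
      unfolding g_def using pos[of w] by (auto intro!: derivative_eq_intros)
    then show ?thesis by (simp add: g'_def power2_eq_square algebra_simps)
  qed
  have g1: "1 - g w = 2 * w\<^sup>2 / (\<delta>\<^sup>2 + w\<^sup>2)" "1 + g w = 2 * \<delta>\<^sup>2 / (\<delta>\<^sup>2 + w\<^sup>2)" for w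
  proof -
    have "\<delta>\<^sup>2 + w\<^sup>2 \<noteq> 0" using pos[of w] by linarith
    then show "1 - g w = 2 * w\<^sup>2 / (\<delta>\<^sup>2 + w\<^sup>2)" "1 + g w = 2 * \<delta>\<^sup>2 / (\<delta>\<^sup>2 + w\<^sup>2)"
      by (simp_all add: g_def divide_simps)
  qed
  have inj: "inj_on g {0<..}"
  proof (rule inj_onI)
    fix x y :: real assume xy: "x \<in> {0<..}" "y \<in> {0<..}" and "g x = g y"
    then have "2 * \<delta>\<^sup>2 / (\<delta>\<^sup>2 + x\<^sup>2) = 2 * \<delta>\<^sup>2 / (\<delta>\<^sup>2 + y\<^sup>2)" by (simp flip: g1)
    then have "x\<^sup>2 = y\<^sup>2" using d pos[of x] pos[of y] by (simp add: field_simps)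
    then show "x = y" using xy by (simp add: power2_eq_iff_nonneg)
  qed
  have img: "g ` {0<..} = {-1<..<1}"
  proof (intro equalityI subsetI)
    fix x assume "x \<in> g ` {0<..}"
    then obtain w where w: "w > 0" "x = g w" by auto
    then have "1 - x > 0" "1 + x > 0" using g1[of w] pos[of w] d by auto
    then show "x \<in> {-1<..<1}" by auto
  next
    fix x :: real assume x: "x \<in> {-1<..<1}"
    define w where "w = \<delta> * sqrt ((1 - x) / (1 + x))"
    have w: "w > 0" using x d by (auto simp: w_def intro!: divide_pos_pos)
    have w2: "w\<^sup>2 = \<delta>\<^sup>2 * ((1 - x) / (1 + x))" using x by (simp add: w_def power_mult_distrib)
    have "\<delta>\<^sup>2 - w\<^sup>2 = x * (\<delta>\<^sup>2 + w\<^sup>2)" using x by (simp add: w2 field_simps)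
    then have "g w = x" using pos[of w] d by (simp add: g_def)
    then show "x \<in> g ` {0<..}" using w by auto
  qed
  have key: "\<bar>g' w\<bar> * h (g w) = k w" if w: "w \<in> {0<..}" for w
  proof -
    define z where "z = - ((of_real w + \<i> * of_real \<delta>) / (of_real w - \<i> * of_real \<delta>))"
    have nz: "of_real w - \<i> * of_real \<delta> \<noteq> 0" using d by (auto simp: complex_eq_iff)
    have nz': "of_real w \<noteq> \<i> * of_real \<delta>" "of_real w \<noteq> - \<i> * of_real \<delta>" using d by (auto simp: complex_eq_iff)
    have nz1: "norm z = 1"
    proof -
      have "of_real w + \<i> * of_real \<delta> = cnj (of_real w - \<i> * of_real \<delta>)" by (simp add: complex_eq_iff)
      then show ?thesis using nz by (simp add: z_def norm_divide del: complex_cnj_diff)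
    qed
    have Rez: "Re z = g w"
      by (simp add: z_def g_def Re_divide power2_eq_square)
        (simp only: minus_divide_left minus_diff_eq add.commute)
    have T: "chebyshev_T n (g w) = (- 1) ^ n * Re (((of_real w + \<i> * of_real \<delta>) / (of_real w - \<i> * of_real \<delta>)) ^ n)"
    proof -
      have "z ^ n = of_real ((- 1) ^ n) * ((of_real w + \<i> * of_real \<delta>) / (of_real w - \<i> * of_real \<delta>)) ^ n"
        unfolding z_def power_minus[of "_ / _"] by simp
      then show ?thesis unfolding Rez[symmetric] chebyshev_T_Re[OF nz1] by (simp only: Re_of_real_mult)
    qed
    have F: "F lam (g w) = exp (- L * w\<^sup>2)"
    proof -
      have "1 + g w \<noteq> 0" using g1(2)[of w] pos[of w] d by simp
      then have "g w \<noteq> -1" by auto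
      moreover have "lam * ((1 - g w) / (1 + g w)) = L * w\<^sup>2"
        unfolding g1 lam using d pos[of w] by simp
      ultimately show ?thesis by (simp add: F_def)
    qed
    have S: "sqrt (1 - (g w)\<^sup>2) = 2 * \<delta> * w / (\<delta>\<^sup>2 + w\<^sup>2)"
    proof -
      have "1 - (g w)\<^sup>2 = (1 - g w) * (1 + g w)" by (simp add: power2_eq_square algebra_simps)
      also have "\<dots> = (2 * \<delta> * w / (\<delta>\<^sup>2 + w\<^sup>2))\<^sup>2" unfolding g1 by (simp add: power2_eq_square)
      finally show ?thesis using w d pos[of w] by simp
    qed
    have K: "Re (kernel \<delta> n L (Complex w 0)) = exp (- L * w\<^sup>2) * Re (((of_real w + \<i> * of_real \<delta>) / (of_real w - \<i> * of_real \<delta>)) ^ n) / (\<delta>\<^sup>2 + w\<^sup>2)"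
    proof -
      have "kernel \<delta> n L (Complex w 0) = of_real (exp (- L * w\<^sup>2)) * ((of_real w + \<i> * of_real \<delta>) / (of_real w - \<i> * of_real \<delta>)) ^ n / of_real (\<delta>\<^sup>2 + w\<^sup>2)"
        using kernel_eq[OF n nz'] by (simp add: Complex_eq exp_of_real[symmetric] add.commute)
      then show ?thesis by (simp only: Re_divide_of_real Re_complex_of_real Re_of_real_mult)
    qed
    have g': "\<bar>g' w\<bar> = 4 * \<delta>\<^sup>2 * w / (\<delta>\<^sup>2 + w\<^sup>2)\<^sup>2"
      using w by (simp add: g'_def abs_mult)
    have "4 * \<delta>\<^sup>2 * w / s\<^sup>2 * (X * (Y * R) / (2 * \<delta> * w / s)) = Y * (2 * \<delta>) * (X * R / s)"
      if "s > 0" for s X Y R :: real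
      using that w d by (simp add: power2_eq_square)
    from this[OF pos] show ?thesis unfolding g' k_def h_def F T S K .
  qed
  have intk: "integrable lborel k"
    unfolding k_def using integrable_kernel_line[OF n d L0, of 0]
    by (intro integrable_mult_right integrable_Re) simp
  have sk: "set_integrable lborel {0<..} k"
    unfolding set_integrable_def using intk by (intro integrable_mult_indicator) auto
  have kS: "k absolutely_integrable_on {0<..}"
    using sk unfolding set_integrable_def by (intro integrable_completion[THEN iffD2]) (auto intro: borel_measurable_integrable)
  have "(\<lambda>w. \<bar>g' w\<bar> * h (g w)) absolutely_integrable_on {0<..}"
    using kS by (rule absolutely_integrable_spike[OF _ negligible_empty]) (simp add: key)
  moreover have "integral {0<..} (\<lambda>w. \<bar>g' w\<bar> * h (g w)) = integral {0<..} k"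
    by (rule Henstock_Kurzweil_Integration.integral_cong) (rule key)
  ultimately have "(\<lambda>w. \<bar>g' w\<bar> * h (g w)) absolutely_integrable_on {0<..} \<and>
      integral {0<..} (\<lambda>w. \<bar>g' w\<bar> * h (g w)) = integral {0<..} k" ..
  then have h: "h absolutely_integrable_on {-1<..<1}" "integral {-1<..<1} h = integral {0<..} k"
    using has_absolute_integral_change_of_variables_1'[of "{0<..}" g g' h "integral {0<..} k"] der inj img by auto
  have hm [measurable]: "h \<in> borel_measurable borel"
    unfolding h_def F_def by measurable
  have hs: "set_integrable lborel {-1<..<1} h"
    using h(1) unfolding set_integrable_def by (subst (asm) integrable_completion) auto
  \<comment> \<open>At \<open>-1\<close> the integrand vanishes with \<open>F\<close>, at \<open>1\<close> by the convention \<open>x / 0 = 0\<close>.\<close>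
  have "(LBINT x:{-1..1}. h x) = (LBINT x:{-1<..<1}. h x)"
    unfolding set_lebesgue_integral_def
    by (intro Bochner_Integration.integral_cong) (auto simp: h_def F_def indicator_def)
  also have "\<dots> = integral {0<..} k" using set_borel_integral_eq_integral(2)[OF hs] h(2) by simp
  also have "\<dots> = (LBINT w:{0<..}. k w)" using set_borel_integral_eq_integral(2)[OF sk] by simp
  also have "\<dots> = (LBINT w:{0..}. k w)"
  proof -
    have "AE w in lborel. w \<noteq> (0::real)" by (rule AE_lborel_singleton)
    then show ?thesis
      unfolding set_lebesgue_integral_def using intk
      by (intro integral_cong_AE) (auto simp: indicator_def intro!: borel_measurable_integrable elim!: eventually_mono)
  qed
  also have "\<dots> = (- 1) ^ n * (2 * \<delta>) * (LBINT w:{0..}. Re (kernel \<delta> n L (Complex w 0)))"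
    unfolding k_def by (rule set_integral_mult_right)
  finally show ?thesis unfolding cheb_coeff_def h_def by simp
qed

text \<open>
  The reflection symmetry of the kernel makes its real part even on every horizontal line. So one can pass
  from the half line to the whole line, shift the contour, and return to the half line \<open>x \<ge> 0\<close>,
  which sees only the right saddle.
\<close>

lemma cheb_coeff_eq_shifted_integral:
  assumes n: "n \<ge> 1" and d: "\<delta> > 0" and L: "L = real n * \<delta>" and lam: "lam = L * \<delta>\<^sup>2" and v: "v \<ge> 0"
  shows "cheb_coeff n lam = (- 1) ^ n * (4 * \<delta> / pi) * Re (LBINT x:{0..}. kernel \<delta> n L (Complex x (- v)))"
proof -
  have L0: "L > 0" using n d L by simp
  have int: "integrable lborel (\<lambda>x. kernel \<delta> n L (Complex x (- y)))" if "y \<ge> 0" for y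
    using that n d L0 by (intro integrable_kernel_line) auto
  have half: "(LBINT x:{0..}. Re (kernel \<delta> n L (Complex x (- y)))) = Re (LBINT x. kernel \<delta> n L (Complex x (- y))) / 2"
    if "y \<ge> 0" for y
    using int[OF that] n by (subst integral_even_half_line) (auto simp: kernel_reflect)
  have "(LBINT x:{0..}. Re (kernel \<delta> n L (Complex x 0))) = (LBINT x:{0..}. Re (kernel \<delta> n L (Complex x (- v))))"
    using half[of 0] half[of v] v kernel_contour_shift[OF n d L0 v] by simp
  also have "\<dots> = Re (LBINT x:{0..}. kernel \<delta> n L (Complex x (- v)))"
  proof -
    have "integrable lborel (\<lambda>x. indicator {0..} x *\<^sub>R kernel \<delta> n L (Complex x (- v)))"
      using int[OF v] by (intro integrable_mult_indicator) auto
    from integral_Re[OF this] show ?thesis by (simp add: set_lebesgue_integral_def)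
  qed
  finally show ?thesis using cheb_coeff_eq_half_line_integral[OF n d L lam] by simp
qed

section \<open>Uniform saddle-point asymptotics\<close>

lemma (in lower_saddle) saddle_term_eq:
  assumes "L > 0" "\<delta> < delta_c"
  shows "saddle_term L \<delta> = exp (of_real L * phase \<delta> w0) * (1 / A * csqrt (of_real (2 * pi) / (of_real L * \<kappa>)))"
  using assms \<delta>_nonneg
  by (simp add: saddle_term_def saddle_sqrt_eq_csqrt saddle_eq phase''_w0 A_def)

text \<open>
  The local contribution of the saddle, for every even cutoff with plateau \<open>[-\<eta>, \<eta>]\<close> and support in
  \<open>[-2\<eta>, 2\<eta>]\<close>. All constants depend on the lower bound \<open>u0\<close> for the distance of the saddle to the
  imaginary axis only.
\<close>

lemma kernel_local_expansion:
  fixes u0 :: real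
  assumes u0: "u0 > 0"
  obtains \<eta> K where "\<eta> > 0" "2 * \<eta> < u0" "K > 0"
    and "\<And>\<delta> u v n L chi. \<lbrakk>lower_saddle \<delta> u v; \<delta> > 0; u0 \<le> u; n \<ge> 1; L = real n * \<delta>;
        chi \<in> borel_measurable borel; \<And>y. chi (- y) = chi y; \<And>y. 0 \<le> chi y; \<And>y. chi y \<le> 1;
        \<And>y. \<bar>y\<bar> \<le> \<eta> \<Longrightarrow> chi y = 1; \<And>y. \<bar>y\<bar> > 2 * \<eta> \<Longrightarrow> chi y = 0\<rbrakk>
      \<Longrightarrow> norm ((LBINT x. of_real (chi (x - u)) * kernel \<delta> n L (Complex x (- v)))
            - exp (of_real L * phase \<delta> (lower_saddle.w0 u v)) *
              (1 / lower_saddle.A \<delta> u v * csqrt (of_real (2 * pi) / (of_real L * lower_saddle.\<kappa> \<delta> u v))))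
          \<le> K * L powr (- 3 / 2) * norm (exp (of_real L * phase \<delta> (lower_saddle.w0 u v)))"
proof -
  define c where "c = 2 * u0\<^sup>2"
  \<comment> \<open>The three bounds: expansions hold for \<open>\<bar>y\<bar> \<le> 1/8\<close>; the line stays in the right half-plane;
    the cubic and quartic terms are dominated by the quadratic one (\<open>2 * 80 * (2 * \<eta>) \<le> c\<close>).\<close>
  define \<eta> where "\<eta> = min (1 / 16) (min (u0 / 4) (c / 320))"
  have c: "c > 0" using u0 by (simp add: c_def)
  have \<eta>: "\<eta> > 0" "2 * \<eta> \<le> 1 / 8" "2 * \<eta> < u0" "2 * 80 * (2 * \<eta>) \<le> c"
    using u0 c by (auto simp: \<eta>_def min_def)
  have "2 * \<eta> \<le> 1" using \<eta> by simp
  moreover have "(0::real) \<le> 80" by simp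
  ultimately obtain K where K: "K > 0"
    and laplace: "\<And>L \<kappa> p g0 g1 \<psi> g chi. \<lbrakk>L > 0; Re \<kappa> \<ge> 4 * c; norm p \<le> 80; norm g0 \<le> 80; norm g1 \<le> 80;
        \<And>y. \<bar>y\<bar> \<le> 2 * \<eta> \<Longrightarrow> norm (\<psi> y + \<kappa> / 2 * of_real y ^ 2 - p * of_real y ^ 3) \<le> 80 * y ^ 4;
        \<And>y. \<bar>y\<bar> \<le> 2 * \<eta> \<Longrightarrow> norm (g y - g0 - g1 * of_real y) \<le> 80 * y\<^sup>2;
        chi \<in> borel_measurable borel; \<And>y. chi (- y) = chi y; \<And>y. 0 \<le> chi y; \<And>y. chi y \<le> 1;
        \<And>y. \<bar>y\<bar> \<le> \<eta> \<Longrightarrow> chi y = 1; \<And>y. \<bar>y\<bar> > 2 * \<eta> \<Longrightarrow> chi y = 0;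
        (\<lambda>y. of_real (chi y) * (exp (of_real L * \<psi> y) * g y)) \<in> borel_measurable borel\<rbrakk>
      \<Longrightarrow> norm ((LBINT y. of_real (chi y) * (exp (of_real L * \<psi> y) * g y))
                - g0 * csqrt (of_real (2 * pi) / (of_real L * \<kappa>))) \<le> K * L powr (- 3 / 2)"
    using laplace_even_cutoff[OF c _ \<eta>(1) _ \<eta>(4)] by blast
  show ?thesis
  proof (rule that[OF \<eta>(1,3) K])
    fix \<delta> u v L :: real and n :: nat and chi :: "real \<Rightarrow> real"
    assume "lower_saddle \<delta> u v" and d: "\<delta> > 0" and u: "u0 \<le> u" and n: "n \<ge> 1" and L: "L = real n * \<delta>"
      and chi [measurable]: "chi \<in> borel_measurable borel" and even: "\<And>y. chi (- y) = chi y"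
      and chi01: "\<And>y. 0 \<le> chi y" "\<And>y. chi y \<le> 1"
      and chi1: "\<And>y. \<bar>y\<bar> \<le> \<eta> \<Longrightarrow> chi y = 1" and chi0: "\<And>y. \<bar>y\<bar> > 2 * \<eta> \<Longrightarrow> chi y = 0"
    interpret lower_saddle \<delta> u v by fact
    have L0: "L > 0" using n d L by simp
    define E0 where "E0 = exp (of_real L * phase \<delta> w0)"
    define \<psi> where "\<psi> = (\<lambda>y. phase \<delta> (w0 + of_real y) - phase \<delta> w0)"
    have E0: "E0 \<noteq> 0" by (simp add: E0_def)
    have ker: "of_real (chi y) * kernel \<delta> n L (Complex (u + y) (- v))
        = E0 * (of_real (chi y) * (exp (of_real L * \<psi> y) * (1 / B y)))" for y
    proof (cases "\<bar>y\<bar> \<le> 2 * \<eta>")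
      case True
      have w: "Complex (u + y) (- v) = w0 + of_real y" by (simp add: w0_def complex_eq_iff)
      have "Re (w0 + of_real y) \<noteq> 0" using True \<eta> u by (auto simp: w0_def)
      then have "kernel \<delta> n L (w0 + of_real y) = exp (of_real L * phase \<delta> (w0 + of_real y)) / B y"
        unfolding B_def by (rule kernel_eq_phase[OF n d L])
      also have "exp (of_real L * phase \<delta> (w0 + of_real y)) = E0 * exp (of_real L * \<psi> y)"
        by (simp add: E0_def \<psi>_def algebra_simps flip: exp_add)
      finally show ?thesis by (simp add: w)
    qed (use chi0 in simp)
    have km [measurable]: "(\<lambda>x. kernel \<delta> n L (Complex x (- v))) \<in> borel_measurable borel"
      using d v_pos by (intro borel_measurable_kernel_line) auto
    have "(\<lambda>y. of_real (chi y) * (exp (of_real L * \<psi> y) * (1 / B y)))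
        = (\<lambda>y. 1 / E0 * (of_real (chi y) * kernel \<delta> n L (Complex (u + y) (- v))))"
      unfolding ker using E0 by simp
    also have "\<dots> \<in> borel_measurable borel"
      using measurable_compose[OF _ km, of "\<lambda>y. u + y" borel] by measurable
    finally have meas: "(\<lambda>y. of_real (chi y) * (exp (of_real L * \<psi> y) * (1 / B y))) \<in> borel_measurable borel" .
    have "norm ((LBINT y. of_real (chi y) * (exp (of_real L * \<psi> y) * (1 / B y)))
                - 1 / A * csqrt (of_real (2 * pi) / (of_real L * \<kappa>))) \<le> K * L powr (- 3 / 2)"
    proof (rule laplace[OF L0 _ _ _ _ _ _ chi even chi01 chi1 chi0 meas])
      show "Re \<kappa> \<ge> 4 * c"
        using Re_\<kappa>_ge power_mono[OF u, of 2] u0 by (simp add: c_def)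
      show "norm (- 2 / 3 * m) \<le> 80" using norm_m_le by (simp add: norm_mult)
      show "norm (1 / A) \<le> 80"
      proof -
        have "1 / norm A \<le> 1 / 1" using norm_A_ge by (intro divide_left_mono) auto
        then show ?thesis by (simp add: norm_divide)
      qed
      show "norm (- 2 * w0 / A\<^sup>2) \<le> 80"
      proof -
        have "1 \<le> (norm A)\<^sup>2" using norm_A_ge by (rule one_le_power)
        then have "2 * norm w0 / (norm A)\<^sup>2 \<le> 2 * 1 / 1" using norm_w0_le by (intro frac_le) auto
        then show ?thesis by (simp add: norm_divide norm_mult norm_power)
      qed
      fix y assume y: "\<bar>y\<bar> \<le> 2 * \<eta>"
      show "norm (\<psi> y + \<kappa> / 2 * of_real y ^ 2 - (- 2 / 3 * m) * of_real y ^ 3) \<le> 80 * y ^ 4"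
        unfolding \<psi>_def using y \<eta> u by (intro phase_expansion) auto
      show "norm (1 / B y - 1 / A - (- 2 * w0 / A\<^sup>2) * of_real y) \<le> 80 * y\<^sup>2"
        using y \<eta> by (intro amplitude_expansion) auto
    qed
    then have "norm (E0 * ((LBINT y. of_real (chi y) * (exp (of_real L * \<psi> y) * (1 / B y)))
                - 1 / A * csqrt (of_real (2 * pi) / (of_real L * \<kappa>)))) \<le> norm E0 * (K * L powr (- 3 / 2))"
      unfolding norm_mult by (intro mult_left_mono) auto
    moreover have "(LBINT x. of_real (chi (x - u)) * kernel \<delta> n L (Complex x (- v)))
        = E0 * (LBINT y. of_real (chi y) * (exp (of_real L * \<psi> y) * (1 / B y)))"
      using lborel_integral_real_affine[of 1 "\<lambda>x. of_real (chi (x - u)) * kernel \<delta> n L (Complex x (- v))" u]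
      by (simp only: ker abs_one scaleR_one mult_1 add_diff_cancel_left' integral_mult_right_zero)
    ultimately show "norm ((LBINT x. of_real (chi (x - u)) * kernel \<delta> n L (Complex x (- v)))
            - exp (of_real L * phase \<delta> w0) * (1 / A * csqrt (of_real (2 * pi) / (of_real L * \<kappa>))))
          \<le> K * L powr (- 3 / 2) * norm (exp (of_real L * phase \<delta> w0))"
      by (simp only: E0_def[symmetric] right_diff_distrib mult_ac)
  qed
qed

text \<open>
  Away from the saddle the bound on the whole line gives an exponentially small contribution, of which
  only a power is needed: half of the exponent is spent on \<open>exp (- c L \<eta>\<^sup>2) \<le> 1 / (c L \<eta>\<^sup>2)\<close>.
\<close>

lemma kernel_tail_bound:
  fixes u0 \<eta> :: real
  assumes u0: "u0 > 0" and \<eta>: "\<eta> > 0" "\<eta> < u0"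
  obtains K where "K > 0"
    and "\<And>\<delta> u v n L. \<lbrakk>lower_saddle \<delta> u v; \<delta> > 0; u0 \<le> u; n \<ge> 2; L = real n * \<delta>\<rbrakk>
      \<Longrightarrow> norm ((LBINT x:{0..}. kernel \<delta> n L (Complex x (- v)))
            - (LBINT x. of_real (indicator {-\<eta>..\<eta>} (x - u)) * kernel \<delta> n L (Complex x (- v))))
          \<le> K * L powr (- 3 / 2) * norm (exp (of_real L * phase \<delta> (lower_saddle.w0 u v)))"
proof -
  define c where "c = u0\<^sup>2 / 36"
  have c: "c > 0" using u0 by (simp add: c_def)
  define K where "K = 40 * exp 2 / (c * \<eta>\<^sup>2) * sqrt (pi / c)"
  have "K > 0" using c \<eta> by (simp add: K_def)
  then show ?thesis
  proof (rule that)
    fix \<delta> u v L :: real and n :: nat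
    assume "lower_saddle \<delta> u v" and d: "\<delta> > 0" and u: "u0 \<le> u" and n: "n \<ge> 2" and L: "L = real n * \<delta>"
    interpret lower_saddle \<delta> u v by fact
    have L0: "L > 0" using n d L by simp
    define N where "N = norm (exp (of_real L * phase \<delta> w0))"
    define k where "k = (\<lambda>x. kernel \<delta> n L (Complex x (- v)))"
    define f where "f = (\<lambda>x. indicator {0..} x *\<^sub>R k x - of_real (indicator {-\<eta>..\<eta>} (x - u)) * k x)"
    have k: "integrable lborel k"
      unfolding k_def using n d L0 v_pos by (intro integrable_kernel_line) auto
    have i1: "integrable lborel (\<lambda>x. indicator {0..} x *\<^sub>R k x)"
      using k by (intro integrable_mult_indicator) auto
    have i2: "integrable lborel (\<lambda>x. of_real (indicator {-\<eta>..\<eta>} (x - u)) * k x)"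
    proof -
      have "integrable lborel (\<lambda>x. indicator {u - \<eta>..u + \<eta>} x *\<^sub>R k x)"
        using k by (intro integrable_mult_indicator) auto
      also have "(\<lambda>x. indicator {u - \<eta>..u + \<eta>} x *\<^sub>R k x) = (\<lambda>x. of_real (indicator {-\<eta>..\<eta>} (x - u)) * k x)"
        by (auto simp: indicator_def fun_eq_iff)
      finally show ?thesis .
    qed
    have fm: "f \<in> borel_measurable borel"
      using borel_measurable_integrable[OF Bochner_Integration.integrable_diff[OF i1 i2]] by (simp add: f_def)
    have fn: "norm (f x) \<le> 40 * exp 2 * N / (c * L * \<eta>\<^sup>2) * exp (- (c * L) * (x - u)\<^sup>2)" for x
    proof (cases "x \<ge> 0 \<and> \<bar>x - u\<bar> > \<eta>")
      case True
      then have "x - u \<notin> {-\<eta>..\<eta>}" by auto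
      then have fx: "f x = k x" using True by (simp add: f_def)
      have "norm (k x) \<le> 40 * exp 2 * N * exp (- (L * u\<^sup>2 / 18) * (x - u)\<^sup>2)"
        unfolding k_def N_def using True by (intro kernel_bound n d L) auto
      also have "exp (- (L * u\<^sup>2 / 18) * (x - u)\<^sup>2) \<le> exp (- (c * L) * (x - u)\<^sup>2) * exp (- (c * L) * (x - u)\<^sup>2)"
      proof -
        have "u0\<^sup>2 \<le> u\<^sup>2" using u u0 by (intro power_mono) auto
        then have "2 * (c * L) \<le> L * u\<^sup>2 / 18" using L0 by (simp add: c_def field_simps)
        then have "- (L * u\<^sup>2 / 18) \<le> - (c * L) + - (c * L)" by (simp add: mult.commute[of c L])
        then have "- (L * u\<^sup>2 / 18) * (x - u)\<^sup>2 \<le> (- (c * L) + - (c * L)) * (x - u)\<^sup>2"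
          by (rule mult_right_mono) simp
        then show ?thesis unfolding exp_add[symmetric] exp_le_cancel_iff distrib_right .
      qed
      also have "exp (- (c * L) * (x - u)\<^sup>2) * exp (- (c * L) * (x - u)\<^sup>2)
          \<le> 1 / (c * L * \<eta>\<^sup>2) * exp (- (c * L) * (x - u)\<^sup>2)"
      proof (intro mult_right_mono)
        have "\<eta>\<^sup>2 \<le> \<bar>x - u\<bar>\<^sup>2" using True \<eta> by (intro power_mono) auto
        then have "exp (- (c * L) * (x - u)\<^sup>2) \<le> exp (- (c * L * \<eta>\<^sup>2))" using c L0 by simp
        also have "\<dots> \<le> 1 / (c * L * \<eta>\<^sup>2)"
          using le_exp_over[of 1 "c * L * \<eta>\<^sup>2"] c L0 \<eta> by (simp add: exp_minus field_simps)
        finally show "exp (- (c * L) * (x - u)\<^sup>2) \<le> 1 / (c * L * \<eta>\<^sup>2)" .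
      qed auto
      finally show ?thesis by (simp add: fx N_def mult_left_mono)
    next
      case False
      then have "f x = 0" using \<eta> u by (auto simp: f_def indicator_def)
      then show ?thesis using c L0 by (simp add: N_def)
    qed
    have "norm (LBINT x. f x) \<le> 40 * exp 2 * N / (c * L * \<eta>\<^sup>2) * sqrt (pi / (c * L))"
      using c L0 by (intro integral_dominated_by_gaussian(2)[OF _ fm fn]) auto
    also have "\<dots> = K * (1 / L * sqrt (1 / L)) * N"
      by (simp add: K_def real_sqrt_divide real_sqrt_mult mult_ac)
    also have "1 / L * sqrt (1 / L) = L powr (- 3 / 2)" by (rule sqrt_inverse_over_eq_powr[OF L0])
    also have "(LBINT x. f x) = (LBINT x:{0..}. k x) - (LBINT x. of_real (indicator {-\<eta>..\<eta>} (x - u)) * k x)"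
      unfolding f_def set_lebesgue_integral_def by (rule Bochner_Integration.integral_diff[OF i1 i2])
    finally show "norm ((LBINT x:{0..}. kernel \<delta> n L (Complex x (- v)))
            - (LBINT x. of_real (indicator {-\<eta>..\<eta>} (x - u)) * kernel \<delta> n L (Complex x (- v))))
          \<le> K * L powr (- 3 / 2) * norm (exp (of_real L * phase \<delta> w0))"
      by (simp only: k_def N_def)
  qed
qed

text \<open>
  Converts the absolute error of the local contribution into a relative one.
\<close>

lemma (in lower_saddle) norm_saddle_term_ge:
  assumes L: "L > 0" and d: "\<delta> < delta_c"
  shows "norm (exp (of_real L * phase \<delta> w0)) * sqrt (1 / L) \<le> 2 * norm (saddle_term L \<delta>)"
proof -
  define s where "s = csqrt (of_real (2 * pi) / (of_real L * \<kappa>))"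
  have "\<kappa> \<noteq> 0" using Re_\<kappa>_pos by auto
  have "sqrt (1 / L) \<le> norm s"
  proof (rule real_le_lsqrt)
    have "(norm s)\<^sup>2 = norm (of_real (2 * pi) / (of_real L * \<kappa>))"
      unfolding norm_power[symmetric] s_def power2_csqrt ..
    also have "\<dots> = 2 * pi / (L * norm \<kappa>)" using L by (simp add: norm_divide norm_mult)
    also have "1 / L \<le> 2 * pi / (L * norm \<kappa>)"
    proof -
      have "norm \<kappa> \<le> 2 * pi" using norm_\<kappa>_le pi_gt3 by linarith
      then show ?thesis using L \<open>\<kappa> \<noteq> 0\<close> by (simp add: field_simps)
    qed
    finally show "1 / L \<le> (norm s)\<^sup>2" .
  qed auto
  also have "norm s \<le> 2 * norm (1 / A * s)"
  proof -
    have "1 \<le> 2 * norm (1 / A)" using norm_A_le A_nz by (simp add: norm_divide field_simps)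
    then show ?thesis unfolding norm_mult using mult_right_mono[of 1 "2 * norm (1 / A)" "norm s"] by simp
  qed
  finally have "norm (exp (of_real L * phase \<delta> w0)) * sqrt (1 / L)
      \<le> norm (exp (of_real L * phase \<delta> w0)) * (2 * norm (1 / A * s))"
    by (intro mult_left_mono) auto
  then show ?thesis unfolding saddle_term_eq[OF L d] s_def[symmetric] by (simp only: norm_mult mult_ac)
qed

text \<open>
  By compactness: this is where \<open>\<alpha>0 < alpha_c\<close> is used, and how the implied constants come to depend on
  \<open>\<alpha>0\<close>.
\<close>

lemma saddle_Re_lower_bound:
  assumes "0 \<le> d0" "d0 < delta_c"
  obtains u0 where "u0 > 0" "\<And>\<delta>. 0 \<le> \<delta> \<Longrightarrow> \<delta> \<le> d0 \<Longrightarrow> u0 \<le> Re (saddle \<delta>)"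
proof -
  have "continuous_on {0..d0} (\<lambda>\<delta>. Re (saddle \<delta>))"
    using assms by (intro continuous_intros continuous_on_subset[OF continuous_on_saddle]) auto
  then obtain d where d: "d \<in> {0..d0}" "\<forall>\<delta>\<in>{0..d0}. Re (saddle d) \<le> Re (saddle \<delta>)"
    using continuous_attains_inf[of "{0..d0}" "\<lambda>\<delta>. Re (saddle \<delta>)"] assms by auto
  have "Re (saddle d) > 0"
    using lower_saddle.u_pos[OF lower_saddle_saddle[of d]] d(1) assms by auto
  then show ?thesis using d(2) by (intro that[of "Re (saddle d)"]) auto
qed

theorem theorem3p6:
  fixes \<alpha>0 :: real
  assumes "0 < \<alpha>0" and "\<alpha>0 < alpha_c"
  shows "\<exists>\<eta>>0. \<exists>K>0. \<exists>L0>0. \<forall>(lam :: nat \<Rightarrow> real) (\<alpha> :: nat \<Rightarrow> real) (\<delta> :: nat \<Rightarrow> real) (\<Lambda> :: nat \<Rightarrow> real).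
           (\<forall>n\<ge>1. lam n > 0) \<longrightarrow>
           (\<forall>n\<ge>1. \<alpha> n = lam n / real n) \<longrightarrow>
           (\<forall>n\<ge>1. 0 < \<alpha> n \<and> \<alpha> n \<le> \<alpha>0) \<longrightarrow>
           (\<forall>n\<ge>1. \<Lambda> n = root 3 (lam n * (real n)\<^sup>2)) \<longrightarrow>
           filterlim \<Lambda> at_top sequentially \<longrightarrow>
           (\<forall>n\<ge>1. \<delta> n = root 3 (\<alpha> n)) \<longrightarrow>
           (\<forall>n\<ge>1. \<Lambda> n \<ge> L0 \<longrightarrow>
              \<bar>cheb_coeff n (lam n) - (-1) ^ n * (4 * \<delta> n / pi) * Re (saddle_term (\<Lambda> n) (\<delta> n))\<bar>
                \<le> K * (\<delta> n * \<Lambda> n powr (-3/2) * exp (\<Lambda> n * Re (phase (\<delta> n) (saddle (\<delta> n)))))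
              \<and>
              (\<forall>chi. cutoff \<eta> chi \<longrightarrow>
                 (\<exists>\<epsilon> :: complex. norm \<epsilon> \<le> K / \<Lambda> n \<and>
                    local_contrib chi (\<Lambda> n) (\<delta> n) = saddle_term (\<Lambda> n) (\<delta> n) * (1 + \<epsilon>))))"
proof -
  define d0 where "d0 = root 3 \<alpha>0"
  have d0: "0 \<le> d0" "d0 < delta_c" using assms by (auto simp: d0_def delta_c_def)
  obtain u0 where u0: "u0 > 0" "\<And>\<delta>. 0 \<le> \<delta> \<Longrightarrow> \<delta> \<le> d0 \<Longrightarrow> u0 \<le> Re (saddle \<delta>)"
    using saddle_Re_lower_bound[OF d0] by blast
  obtain \<eta> K1 where \<eta>: "\<eta> > 0" "2 * \<eta> < u0" and K1: "K1 > 0"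
    and loc: "\<And>\<delta> u v n L chi. \<lbrakk>lower_saddle \<delta> u v; \<delta> > 0; u0 \<le> u; n \<ge> 1; L = real n * \<delta>;
        chi \<in> borel_measurable borel; \<And>y. chi (- y) = chi y; \<And>y. 0 \<le> chi y; \<And>y. chi y \<le> 1;
        \<And>y. \<bar>y\<bar> \<le> \<eta> \<Longrightarrow> chi y = 1; \<And>y. \<bar>y\<bar> > 2 * \<eta> \<Longrightarrow> chi y = 0\<rbrakk>
      \<Longrightarrow> norm ((LBINT x. of_real (chi (x - u)) * kernel \<delta> n L (Complex x (- v)))
            - exp (of_real L * phase \<delta> (lower_saddle.w0 u v)) *
              (1 / lower_saddle.A \<delta> u v * csqrt (of_real (2 * pi) / (of_real L * lower_saddle.\<kappa> \<delta> u v))))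
          \<le> K1 * L powr (- 3 / 2) * norm (exp (of_real L * phase \<delta> (lower_saddle.w0 u v)))"
    using kernel_local_expansion[OF u0(1)] by blast
  have "\<eta> < u0" using \<eta> by simp
  then obtain K2 where K2: "K2 > 0"
    and tail: "\<And>\<delta> u v n L. \<lbrakk>lower_saddle \<delta> u v; \<delta> > 0; u0 \<le> u; n \<ge> 2; L = real n * \<delta>\<rbrakk>
      \<Longrightarrow> norm ((LBINT x:{0..}. kernel \<delta> n L (Complex x (- v)))
            - (LBINT x. of_real (indicator {-\<eta>..\<eta>} (x - u)) * kernel \<delta> n L (Complex x (- v))))
          \<le> K2 * L powr (- 3 / 2) * norm (exp (of_real L * phase \<delta> (lower_saddle.w0 u v)))"
    using kernel_tail_bound[OF u0(1) \<eta>(1)] by blast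
  define K where "K = 2 * (K1 + K2)"
  have main: "\<bar>cheb_coeff n lam - (-1) ^ n * (4 * \<delta> / pi) * Re (saddle_term L \<delta>)\<bar>
                \<le> K * (\<delta> * L powr (-3/2) * exp (L * Re (phase \<delta> (saddle \<delta>))))
      \<and> (\<forall>chi. cutoff \<eta> chi \<longrightarrow>
            (\<exists>\<epsilon> :: complex. norm \<epsilon> \<le> K / L \<and> local_contrib chi L \<delta> = saddle_term L \<delta> * (1 + \<epsilon>)))"
    if n: "n \<ge> 1" and d: "0 < \<delta>" "\<delta> \<le> d0" and L: "L = real n * \<delta>" and lam: "lam = L * \<delta>\<^sup>2" and L4: "L \<ge> 4"
    for n :: nat and lam \<delta> L :: real
  proof -
    have dc: "\<delta> < delta_c" using d d0 by simp
    define u where "u = Re (saddle \<delta>)"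
    define v where "v = - Im (saddle \<delta>)"
    have ls: "lower_saddle \<delta> u v" unfolding u_def v_def using d dc by (intro lower_saddle_saddle) auto
    interpret lower_saddle \<delta> u v by (rule ls)
    have u: "u0 \<le> u" unfolding u_def using u0(2) d by simp
    have L0: "L > 0" using L4 by simp
    define E where "E = norm (exp (of_real L * phase \<delta> w0))"
    have E: "exp (L * Re (phase \<delta> (saddle \<delta>))) = E" by (simp add: E_def saddle_eq)
    \<comment> \<open>\<open>L = n \<delta> \<ge> 4\<close> and \<open>\<delta> < 2\<close>.\<close>
    have n2: "n \<ge> 2"
    proof (rule ccontr)
      assume "\<not> n \<ge> 2"
      then have "n = 1" using n by simp
      then show False using L L4 \<delta>_less_2 by simp
    qed
    have st: "saddle_term L \<delta> = exp (of_real L * phase \<delta> w0) * (1 / A * csqrt (of_real (2 * pi) / (of_real L * \<kappa>)))"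
      by (rule saddle_term_eq[OF L0 dc])
    define I where "I = (LBINT x:{0..}. kernel \<delta> n L (Complex x (- v)))"
    define J where "J = (LBINT x. of_real (indicator {-\<eta>..\<eta>} (x - u)) * kernel \<delta> n L (Complex x (- v)))"
    have IJ: "norm (I - J) \<le> K2 * L powr (- 3 / 2) * E"
      unfolding I_def J_def E_def by (rule tail[OF ls d(1) u n2 L])
    have JS: "norm (J - saddle_term L \<delta>) \<le> K1 * L powr (- 3 / 2) * E"
      unfolding J_def E_def st
      by (rule loc[OF ls d(1) u n L]) (use \<eta> in \<open>auto simp: indicator_def\<close>)
    \<comment> \<open>\<open>J\<close> is the local contribution for the sharp cutoff at distance \<open>\<eta>\<close>.\<close>
    have IS: "norm (I - saddle_term L \<delta>) \<le> (K1 + K2) * L powr (- 3 / 2) * E"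
      using norm_triangle_ineq[of "I - J" "J - saddle_term L \<delta>"] IJ JS by (simp add: ring_distribs)
    have "cheb_coeff n lam - (-1) ^ n * (4 * \<delta> / pi) * Re (saddle_term L \<delta>)
        = (-1) ^ n * (4 * \<delta> / pi) * Re (I - saddle_term L \<delta>)"
      unfolding cheb_coeff_eq_shifted_integral[OF n d(1) L lam less_imp_le[OF v_pos]] I_def
      by (simp add: algebra_simps)
    then have "\<bar>cheb_coeff n lam - (-1) ^ n * (4 * \<delta> / pi) * Re (saddle_term L \<delta>)\<bar>
        = 4 * \<delta> / pi * \<bar>Re (I - saddle_term L \<delta>)\<bar>"
      using d by (simp add: abs_mult)
    also have "\<dots> \<le> 2 * \<delta> * ((K1 + K2) * L powr (- 3 / 2) * E)"
    proof (intro mult_mono)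
      show "4 * \<delta> / pi \<le> 2 * \<delta>" using d pi_ge_two by (simp add: field_simps)
      show "\<bar>Re (I - saddle_term L \<delta>)\<bar> \<le> (K1 + K2) * L powr (- 3 / 2) * E"
        using abs_Re_le_cmod[of "I - saddle_term L \<delta>"] IS by linarith
    qed (use d in auto)
    also have "\<dots> = K * (\<delta> * L powr (-3/2) * E)" by (simp add: K_def)
    finally have first: "\<bar>cheb_coeff n lam - (-1) ^ n * (4 * \<delta> / pi) * Re (saddle_term L \<delta>)\<bar>
        \<le> K * (\<delta> * L powr (-3/2) * exp (L * Re (phase \<delta> (saddle \<delta>))))" by (simp only: E)
    have "\<exists>\<epsilon> :: complex. norm \<epsilon> \<le> K / L \<and> local_contrib chi L \<delta> = saddle_term L \<delta> * (1 + \<epsilon>)"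
      if cut: "cutoff \<eta> chi" for chi
    proof -
      have "\<And>x. isCont chi x"
        using cut unfolding cutoff_def by (metis field_differentiable_imp_continuous_at funpow_0)
      then have chi: "chi \<in> borel_measurable borel"
        by (intro borel_measurable_continuous_onI continuous_at_imp_continuous_on) auto
      define C where "C = (LBINT x. of_real (chi (x - u)) * kernel \<delta> n L (Complex x (- v)))"
      have lc: "local_contrib chi L \<delta> = C"
        unfolding local_contrib_def Let_def C_def u_def[symmetric] v_def[symmetric]
      proof (rule Bochner_Integration.integral_cong)
        fix x
        show "complex_of_real (chi (x - u)) * (exp (of_real L * phase \<delta> (Complex x (- v))) / ((Complex x (- v))\<^sup>2 + of_real (\<delta>\<^sup>2)))
            = of_real (chi (x - u)) * kernel \<delta> n L (Complex x (- v))"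
        proof (cases "\<bar>x - u\<bar> \<ge> 2 * \<eta>")
          case True
          then show ?thesis using cut unfolding cutoff_def by simp
        next
          case False
          then have "Re (Complex x (- v)) \<noteq> 0" using \<eta> u by auto
          then show ?thesis using kernel_eq_phase[OF n d(1) L] by simp
        qed
      qed simp
      have CS: "norm (C - saddle_term L \<delta>) \<le> K1 * L powr (- 3 / 2) * E"
        unfolding C_def E_def st
        by (rule loc[OF ls d(1) u n L chi]) (use cut in \<open>auto simp: cutoff_def\<close>)
      also have "\<dots> = K1 / L * (E * sqrt (1 / L))"
        unfolding sqrt_inverse_over_eq_powr[OF L0, symmetric] by simp
      also have "\<dots> \<le> K1 / L * (2 * norm (saddle_term L \<delta>))"
        unfolding E_def using K1 L0 by (intro mult_left_mono norm_saddle_term_ge dc) auto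
      finally have b: "norm (C - saddle_term L \<delta>) \<le> 2 * K1 / L * norm (saddle_term L \<delta>)"
        by (simp add: mult.commute mult.left_commute)
      have "norm (saddle_term L \<delta>) > 0"
      proof -
        have "0 < norm (exp (of_real L * phase \<delta> w0)) * sqrt (1 / L)" using L0 by simp
        then show ?thesis using norm_saddle_term_ge[OF L0 dc] by linarith
      qed
      then have nz: "norm (saddle_term L \<delta>) > 0" "saddle_term L \<delta> \<noteq> 0" by auto
      have "2 * K1 / L \<le> K / L" using K2 L0 by (simp add: K_def divide_right_mono)
      moreover have "norm ((C - saddle_term L \<delta>) / saddle_term L \<delta>) \<le> 2 * K1 / L"
        using b nz by (simp add: norm_divide divide_le_eq)
      moreover have "C = saddle_term L \<delta> * (1 + (C - saddle_term L \<delta>) / saddle_term L \<delta>)"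
        using nz by (simp add: field_simps)
      ultimately show ?thesis unfolding lc by (metis order_trans)
    qed
    then show ?thesis using first by blast
  qed
  have "K > 0" using K1 K2 by (simp add: K_def)
  show ?thesis
  proof (rule exI[of _ \<eta>], rule conjI[OF \<eta>(1)], rule exI[of _ K], rule conjI[OF \<open>K > 0\<close>],
      rule exI[of _ 4], rule conjI, simp, intro allI impI)
    fix lam \<alpha> \<delta> \<Lambda> :: "nat \<Rightarrow> real" and n :: nat
    assume lam0: "\<forall>n\<ge>1. lam n > 0" and al: "\<forall>n\<ge>1. \<alpha> n = lam n / real n"
      and al0: "\<forall>n\<ge>1. 0 < \<alpha> n \<and> \<alpha> n \<le> \<alpha>0" and La: "\<forall>n\<ge>1. \<Lambda> n = root 3 (lam n * (real n)\<^sup>2)"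
      and de: "\<forall>n\<ge>1. \<delta> n = root 3 (\<alpha> n)" and n: "1 \<le> n" and L4: "4 \<le> \<Lambda> n"
    have d3: "\<delta> n ^ 3 = lam n / real n" using de al al0 n by (metis less_imp_le odd_real_root_pow odd_numeral)
    have dpos: "0 < \<delta> n" and dle: "\<delta> n \<le> d0" using de al0 n by (auto simp: d0_def)
    have L: "\<Lambda> n = real n * \<delta> n"
    proof -
      have "(real n * \<delta> n) ^ 3 = real n ^ 3 * (lam n / real n)" by (simp only: power_mult_distrib d3)
      also have "\<dots> = lam n * (real n)\<^sup>2" using n by (simp add: power2_eq_square power3_eq_cube)
      finally have "(real n * \<delta> n) ^ 3 = lam n * (real n)\<^sup>2" .
      then show ?thesis
        using La n dpos by (simp add: real_root_pos_unique)
    qed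
    have "\<Lambda> n * (\<delta> n)\<^sup>2 = real n * \<delta> n ^ 3" by (simp add: L power2_eq_square power3_eq_cube)
    then have "lam n = \<Lambda> n * (\<delta> n)\<^sup>2" using n by (simp add: d3)
    from main[OF n dpos dle L this L4]
    show "\<bar>cheb_coeff n (lam n) - (-1) ^ n * (4 * \<delta> n / pi) * Re (saddle_term (\<Lambda> n) (\<delta> n))\<bar>
                \<le> K * (\<delta> n * \<Lambda> n powr (-3/2) * exp (\<Lambda> n * Re (phase (\<delta> n) (saddle (\<delta> n)))))
              \<and>
              (\<forall>chi. cutoff \<eta> chi \<longrightarrow>
                 (\<exists>\<epsilon> :: complex. norm \<epsilon> \<le> K / \<Lambda> n \<and>
                    local_contrib chi (\<Lambda> n) (\<delta> n) = saddle_term (\<Lambda> n) (\<delta> n) * (1 + \<epsilon>)))" .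
  qed
qed

end
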